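(* Let $X$ be a completely regular space and let $H$ be a non-vanishing closed ideal in $C_B(X)$. The following are equivalent: (1) $\mathfrak{sp}(H)$ is strongly zero-dimensional. (2) $X$ is strongly zero-dimensional. (3) Every closed ideal $G$ of $C_B(X)$ is generated by idempotents, that is, \[G=\overline{\langle g\in G: g^2=g\rangle},\] where the bar denotes the closure in $C_B(X)$. (4) For every closed ideal $G$ of $C_B(X)$, the ideal $C_B(X)/G$ is either zero, simple, or the closure (in the quotient space $C_B(X)/G$) of a decomposable ideal in $C_B(X)/G$.
   Context: Completely regular spaces are assumed to be Hausdorff. The scalar field $\mathbb{F}$ is either $\mathbb{R}$ or $\mathbb{C}$ and is fixed. For a space $X$, $C_B(X)$ is the Banach algebra of all bounded continuous mappings $X\to\mathbb{F}$ with pointwise addition and multiplication and the supremum norm. For completely regular $X$, $\beta X$ is the Stone–Čech compactification, and for $f\in C_B(X)$, $f_\beta$ denotes the unique continuous extension of $f$ to $\beta X$. The cozero-set of $f:Y\to\mathbb{F}$ is $\mathrm{Coz}(f)=\{y\in Y: f(y)\neq 0\}$. An ideal $H$ of $C_B(X)$ is non-vanishing if there is no point of $X$ at which every element of $H$ vanishes. For a non-vanishing closed ideal $H$, its spectrum is the subspace $\mathfrak{sp}(H)=\bigcup_{h\in H}\mathrm{Coz}(h_\beta)$ of $\beta X$. For a subset $A$ of a ring $R$, $\langle A\rangle$ is the ideal of $R$ generated by $A$ (here $R=C_B(X)$). The quotient $C_B(X)/G$ carries the quotient norm $\|x+G\|=\inf_{g\in G}\|x-g\|$. A non-zero ideal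 $J$ in a ring $R$ is simple if it contains no proper non-zero subideal (ideal of $R$), equivalently, if every non-zero element of $J$ generates $J$. An ideal of a ring $R$ is decomposable if it equals $I\oplus J$ (internal direct sum) for some non-zero ideals $I$ and $J$ of $R$. Two subsets $A,B$ of a space $Y$ are completely separated if there is a continuous $f:Y\to[0,1]$ with $f|_A=0$ and $f|_B=1$. A completely regular space $Y$ is strongly zero-dimensional if every two completely separated subsets of $Y$ are separated by (contained respectively in) two disjoint open-and-closed subsets of $Y$. *)

theory Defs
  imports "HOL-Analysis.Analysis" "HOL-Algebra.QuotRing"
begin

section \<open>The normed ring of bounded continuous functions\<close>

text \<open>
  The scalar field is a type \<open>'f\<close>; it is meant to be \<^typ>\<open>real\<close> or \<^typ>\<open>complex\<close>.
  Functions on a space \<open>X\<close> are represented by functions that are \<^const>\<open>undefined\<close> off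
  \<^term>\<open>topspace X\<close>, so that equality of functions on \<open>X\<close> is equality in HOL.
  The distance of \<^const>\<open>cfunspace\<close> is the supremum distance.
\<close>

definition CB_metric :: "'a topology \<Rightarrow> ('a \<Rightarrow> 'f::real_normed_field) metric"
  where "CB_metric X = cfunspace X euclidean_metric"

definition CB :: "'a topology \<Rightarrow> ('a \<Rightarrow> 'f::real_normed_field) ring"
  where "CB X =
    \<lparr>carrier = mspace (CB_metric X),
     mult = (\<lambda>f g. \<lambda>x\<in>topspace X. f x * g x),
     one = (\<lambda>x\<in>topspace X. 1),
     zero = (\<lambda>x\<in>topspace X. 0),
     add = (\<lambda>f g. \<lambda>x\<in>topspace X. f x + g x)\<rparr>"

definition CB_norm :: "'a topology \<Rightarrow> ('a \<Rightarrow> 'f::real_normed_field) \<Rightarrow> real"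
  where "CB_norm X f = mdist (CB_metric X) f \<zero>\<^bsub>CB X\<^esub>"

abbreviation CB_closure ::
    "'a topology \<Rightarrow> ('a \<Rightarrow> 'f::real_normed_field) set \<Rightarrow> ('a \<Rightarrow> 'f) set"
  where "CB_closure X A \<equiv> mtopology_of (CB_metric X) closure_of A"

definition closed_ideal :: "'a topology \<Rightarrow> ('a \<Rightarrow> 'f::real_normed_field) set \<Rightarrow> bool"
  where "closed_ideal X G \<longleftrightarrow> ideal G (CB X) \<and> closedin (mtopology_of (CB_metric X)) G"

definition non_vanishing :: "'a topology \<Rightarrow> ('a \<Rightarrow> 'f::real_normed_field) set \<Rightarrow> bool"
  where "non_vanishing X H \<longleftrightarrow> \<not> (\<exists>x\<in>topspace X. \<forall>h\<in>H. h x = 0)"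


section \<open>The quotient of the ring by a closed ideal\<close>

text \<open>
  An element of \<^term>\<open>CB X Quot G\<close> is a coset. Since the coset of \<open>x\<close> is the set of all
  \<open>x - g\<close> with \<open>g \<in> G\<close>, its quotient norm is the infimum of the norms of its elements.
  The value \<open>0\<close> of \<open>quot_dist\<close> off the carrier is a dummy value: \<^locale>\<open>Metric_space\<close>
  requires non-negativity and symmetry of the distance on the whole type.
\<close>

definition quot_norm :: "'a topology \<Rightarrow> ('a \<Rightarrow> 'f::real_normed_field) set \<Rightarrow> real"
  where "quot_norm X \<xi> = (INF f\<in>\<xi>. CB_norm X f)"

definition quot_dist ::
    "'a topology \<Rightarrow> ('a \<Rightarrow> 'f::real_normed_field) set \<Rightarrow> ('a \<Rightarrow> 'f) set \<Rightarrow> ('a \<Rightarrow> 'f) set \<Rightarrow> real"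
  where "quot_dist X G \<xi> \<eta> =
    (if \<xi> \<in> carrier (CB X Quot G) \<and> \<eta> \<in> carrier (CB X Quot G)
     then quot_norm X (\<xi> \<ominus>\<^bsub>CB X Quot G\<^esub> \<eta>) else 0)"

abbreviation quot_closure ::
    "'a topology \<Rightarrow> ('a \<Rightarrow> 'f::real_normed_field) set \<Rightarrow> ('a \<Rightarrow> 'f) set set \<Rightarrow> ('a \<Rightarrow> 'f) set set"
  where "quot_closure X G A \<equiv>
    Metric_space.mtopology (carrier (CB X Quot G)) (quot_dist X G) closure_of A"


section \<open>Simple and decomposable ideals of a ring\<close>

definition simple_ideal :: "('a, 'm) ring_scheme \<Rightarrow> 'a set \<Rightarrow> bool"
  where "simple_ideal R J \<longleftrightarrow>
    ideal J R \<and> J \<noteq> {\<zero>\<^bsub>R\<^esub>} \<and> (\<forall>I. ideal I R \<and> I \<subseteq> J \<longrightarrow> I = {\<zero>\<^bsub>R\<^esub>} \<or> I = J)"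

definition decomposable_ideal :: "('a, 'm) ring_scheme \<Rightarrow> 'a set \<Rightarrow> bool"
  where "decomposable_ideal R D \<longleftrightarrow>
    (\<exists>I J. ideal I R \<and> ideal J R \<and> I \<noteq> {\<zero>\<^bsub>R\<^esub>} \<and> J \<noteq> {\<zero>\<^bsub>R\<^esub>} \<and>
           I \<inter> J = {\<zero>\<^bsub>R\<^esub>} \<and> D = I <+>\<^bsub>R\<^esub> J)"


section \<open>The Stone-Cech compactification and the spectrum\<close>

text \<open>
  The compactification is realised as the closure of the image of \<open>X\<close> under the canonical map
  into the cube with one factor \<open>[0,1]\<close> for each continuous function \<open>X \<rightarrow> [0,1]\<close>; this is
  the map of \<open>completely_regular_space_cube_embedding_explicit\<close>.
\<close>

definition unit_functions :: "'a topology \<Rightarrow> ('a \<Rightarrow> real) set"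
  where "unit_functions X =
    mspace (submetric (cfunspace X euclidean_metric) {f. f \<in> topspace X \<rightarrow> {0..1}})"

definition unit_cube :: "'a topology \<Rightarrow> (('a \<Rightarrow> real) \<Rightarrow> real) topology"
  where "unit_cube X = product_topology (\<lambda>f. top_of_set {0..1::real}) (unit_functions X)"

definition beta_embed :: "'a topology \<Rightarrow> 'a \<Rightarrow> ('a \<Rightarrow> real) \<Rightarrow> real"
  where "beta_embed X x = (\<lambda>f\<in>unit_functions X. f x)"

definition beta :: "'a topology \<Rightarrow> (('a \<Rightarrow> real) \<Rightarrow> real) topology"
  where "beta X = subtopology (unit_cube X) (unit_cube X closure_of (beta_embed X ` topspace X))"

definition is_beta_extension ::
    "'a topology \<Rightarrow> ('a \<Rightarrow> 'f::real_normed_field) \<Rightarrow> ((('a \<Rightarrow> real) \<Rightarrow> real) \<Rightarrow> 'f) \<Rightarrow> bool"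
  where "is_beta_extension X f F \<longleftrightarrow>
    F \<in> extensional (topspace (beta X)) \<and> continuous_map (beta X) euclidean F \<and>
    (\<forall>x\<in>topspace X. F (beta_embed X x) = f x)"

definition beta_extension ::
    "'a topology \<Rightarrow> ('a \<Rightarrow> 'f::real_normed_field) \<Rightarrow> (('a \<Rightarrow> real) \<Rightarrow> real) \<Rightarrow> 'f"
  where "beta_extension X f = (THE F. is_beta_extension X f F)"

definition Coz :: "'b topology \<Rightarrow> ('b \<Rightarrow> 'f::zero) \<Rightarrow> 'b set"
  where "Coz Y f = {y \<in> topspace Y. f y \<noteq> 0}"

definition spectrum_space ::
    "'a topology \<Rightarrow> ('a \<Rightarrow> 'f::real_normed_field) set \<Rightarrow> (('a \<Rightarrow> real) \<Rightarrow> real) topology"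
  where "spectrum_space X H = subtopology (beta X) (\<Union>h\<in>H. Coz (beta X) (beta_extension X h))"


section \<open>Strong zero-dimensionality\<close>

definition completely_separated :: "'b topology \<Rightarrow> 'b set \<Rightarrow> 'b set \<Rightarrow> bool"
  where "completely_separated Y A B \<longleftrightarrow>
    A \<subseteq> topspace Y \<and> B \<subseteq> topspace Y \<and>
    (\<exists>f. continuous_map Y (top_of_set {0..1::real}) f \<and> (\<forall>x\<in>A. f x = 0) \<and> (\<forall>x\<in>B. f x = 1))"

definition strongly_zero_dimensional :: "'b topology \<Rightarrow> bool"
  where "strongly_zero_dimensional Y \<longleftrightarrow>
    completely_regular_space Y \<and> Hausdorff_space Y \<and>
    (\<forall>A B. completely_separated Y A B \<longrightarrow>
       (\<exists>U V. openin Y U \<and> closedin Y U \<and> openin Y V \<and> closedin Y V \<and>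
              disjnt U V \<and> A \<subseteq> U \<and> B \<subseteq> V))"


section \<open>Well-definedness of the notions\<close>

lemma carrier_CB:
  "carrier (CB X) =
     {f. f \<in> extensional (topspace X) \<and> continuous_map X euclidean f \<and> bounded (f ` topspace X)}"
  by (auto simp: CB_def CB_metric_def)

lemma CB_simps:
  "f \<otimes>\<^bsub>CB X\<^esub> g = (\<lambda>x\<in>topspace X. f x * g x)"
  "f \<oplus>\<^bsub>CB X\<^esub> g = (\<lambda>x\<in>topspace X. f x + g x)"
  "\<one>\<^bsub>CB X\<^esub> = (\<lambda>x\<in>topspace X. 1)" "\<zero>\<^bsub>CB X\<^esub> = (\<lambda>x\<in>topspace X. 0)"
  by (simp_all add: CB_def)

lemma continuous_map_restrict_iff: "continuous_map X Y (restrict f (topspace X)) \<longleftrightarrow> continuous_map X Y f"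
  by (rule iffI) (erule continuous_map_eq, simp)+

lemma bounded_image_field_ops:
  fixes f g :: "'a \<Rightarrow> 'f::real_normed_field"
  assumes "bounded (f ` S)" "bounded (g ` S)"
  shows "bounded ((\<lambda>x. f x + g x) ` S)" "bounded ((\<lambda>x. f x * g x) ` S)" "bounded ((\<lambda>x. - f x) ` S)"
proof -
  obtain a b where a: "\<And>x. x \<in> S \<Longrightarrow> norm (f x) \<le> a" and b: "\<And>x. x \<in> S \<Longrightarrow> norm (g x) \<le> b"
    using assms unfolding bounded_iff by blast
  have "norm (f x + g x) \<le> a + b" if "x \<in> S" for x
    using norm_triangle_mono a b that by blast
  then show "bounded ((\<lambda>x. f x + g x) ` S)" by (auto simp: bounded_iff)
  have "norm (f x * g x) \<le> a * b" if "x \<in> S" for x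
    unfolding norm_mult by (rule mult_mono) (use a b that order_trans[OF norm_ge_zero a] in auto)
  then show "bounded ((\<lambda>x. f x * g x) ` S)" by (auto simp: bounded_iff)
  show "bounded ((\<lambda>x. - f x) ` S)" using a by (auto simp: bounded_iff)
qed

lemma continuous_map_field_ops:
  fixes f g :: "'a \<Rightarrow> 'f::real_normed_field"
  assumes "continuous_map X euclidean f" "continuous_map X euclidean g"
  shows "continuous_map X euclidean (\<lambda>x. f x + g x)"
    "continuous_map X euclidean (\<lambda>x. f x * g x)"
    "continuous_map X euclidean (\<lambda>x. - f x)"
  using assms unfolding continuous_map_atin by (auto intro: tendsto_intros)

lemma cring_CB: "cring (CB X :: ('a \<Rightarrow> 'f::real_normed_field) ring)"
proof (rule cringI)
  show "abelian_group (CB X :: ('a \<Rightarrow> 'f::real_normed_field) ring)"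
  proof (rule abelian_groupI)
    fix f :: "'a \<Rightarrow> 'f" assume "f \<in> carrier (CB X)"
    then show "\<exists>g\<in>carrier (CB X). g \<oplus>\<^bsub>CB X\<^esub> f = \<zero>\<^bsub>CB X\<^esub>"
      by (intro bexI[of _ "\<lambda>x\<in>topspace X. - f x"])
        (auto simp: CB_simps carrier_CB continuous_map_restrict_iff continuous_map_field_ops bounded_image_field_ops cong: image_cong)
  qed (auto simp: CB_simps carrier_CB continuous_map_restrict_iff continuous_map_field_ops bounded_image_field_ops algebra_simps
        extensional_def fun_eq_iff image_constant_conv cong: image_cong)
  show "comm_monoid (CB X :: ('a \<Rightarrow> 'f) ring)"
    by (rule comm_monoidI)
      (auto simp: CB_simps carrier_CB continuous_map_restrict_iff continuous_map_field_ops bounded_image_field_ops algebra_simps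
        extensional_def fun_eq_iff image_constant_conv cong: image_cong)
qed (auto simp: CB_simps carrier_CB algebra_simps fun_eq_iff)

lemma beta_embed_in: "x \<in> topspace X \<Longrightarrow> beta_embed X x \<in> topspace (unit_cube X)"
  by (auto simp: unit_cube_def beta_embed_def unit_functions_def)

lemma compact_beta: "compact_space (beta X)"
proof -
  have "compact_space (unit_cube X)"
    unfolding unit_cube_def
    by (simp add: compact_space_product_topology compact_space_subtopology)
  then show ?thesis unfolding beta_def
    by (simp add: closedin_compact_space compact_space_subtopology)
qed

lemma Hausdorff_beta: "Hausdorff_space (beta X)"
  unfolding beta_def unit_cube_def
  by (simp add: Hausdorff_space_product_topology Hausdorff_space_subtopology)

lemma topspace_beta: "topspace (beta X) = unit_cube X closure_of (beta_embed X ` topspace X)"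
  unfolding beta_def by (simp add: closure_of_subset_topspace inf.absorb2)

lemma beta_embed_image: "beta_embed X ` topspace X \<subseteq> topspace (beta X)"
  unfolding topspace_beta by (rule closure_of_subset) (auto simp: beta_embed_in)

lemma beta_dense: "beta X closure_of (beta_embed X ` topspace X) = topspace (beta X)"
  using beta_embed_image[of X] unfolding topspace_beta
  by (simp add: beta_def closure_of_subtopology inf.absorb2)

lemma embedding_beta:
  assumes "completely_regular_space X" "Hausdorff_space X"
  shows "embedding_map X (beta X) (beta_embed X)"
proof -
  have "embedding_map X (unit_cube X) (beta_embed X)"
    using completely_regular_space_cube_embedding_explicit[OF assms]
    unfolding unit_cube_def unit_functions_def beta_embed_def[abs_def] .
  then show ?thesis
    using beta_embed_image[of X] unfolding beta_def topspace_beta[unfolded beta_def]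
    by (simp add: embedding_map_in_subtopology topspace_beta)
qed

lemma beta_extension_unique:
  assumes "is_beta_extension X f F" "is_beta_extension X f F'"
  shows "F = F'"
proof (rule extensionalityI[where A="topspace (beta X)"])
  fix y assume y: "y \<in> topspace (beta X)"
  show "F y = F' y"
    by (rule forall_in_closure_of_eq[of y "beta X" "beta_embed X ` topspace X" euclidean])
      (use assms y in \<open>auto simp: beta_dense is_beta_extension_def\<close>)
qed (use assms in \<open>auto simp: is_beta_extension_def\<close>)

lemma ex_extension_real:
  fixes f :: "'a \<Rightarrow> real"
  assumes "continuous_map X euclidean f" "bounded (f ` topspace X)"
  shows "\<exists>F. continuous_map (beta X) euclidean F \<and> (\<forall>x\<in>topspace X. F (beta_embed X x) = f x)"
proof -
  obtain B where B: "B > 0" "\<And>x. x \<in> topspace X \<Longrightarrow> \<bar>f x\<bar> \<le> B"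
    using assms(2) unfolding bounded_pos by auto
  define g where "g = (\<lambda>x\<in>topspace X. (f x + B) / (2 * B))"
  have g01: "g \<in> topspace X \<rightarrow> {0..1}"
    using B by (fastforce simp: g_def divide_simps abs_le_iff)
  moreover have "bounded (g ` topspace X)"
    by (rule bounded_subset[OF bounded_closed_interval[of 0 1]]) (use g01 in auto)
  moreover have "continuous_map X euclidean g"
    unfolding g_def continuous_map_restrict_iff using B assms by (auto intro!: continuous_intros)
  ultimately have gK: "g \<in> unit_functions X"
    by (auto simp: unit_functions_def g_def)
  have "continuous_map (unit_cube X) (top_of_set {0..1::real}) (\<lambda>z. z g)"
    unfolding unit_cube_def by (rule continuous_map_product_projection[OF gK])
  then have "continuous_map (beta X) euclideanreal (\<lambda>z. z g)"
    unfolding beta_def by (metis continuous_map_from_subtopology continuous_map_into_fulltopology)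
  then have "continuous_map (beta X) euclideanreal (\<lambda>z. 2 * B * z g - B)"
    by (auto intro!: continuous_intros)
  moreover have "2 * B * beta_embed X x g - B = f x" if "x \<in> topspace X" for x
    using B that gK by (simp add: beta_embed_def g_def)
  ultimately show ?thesis by blast
qed

lemma is_beta_extension_restrict:
  assumes "continuous_map (beta X) euclidean F" "\<And>x. x\<in>topspace X \<Longrightarrow> F (beta_embed X x) = f x"
  shows "is_beta_extension X f (restrict F (topspace (beta X)))"
  using assms beta_embed_image[of X] by (auto simp: is_beta_extension_def continuous_map_restrict_iff)

lemma beta_extension_real:
  assumes "f \<in> carrier (CB X :: ('a \<Rightarrow> real) ring)"
  shows "is_beta_extension X f (beta_extension X f)"
proof -
  obtain F where "is_beta_extension X f F"
    using ex_extension_real[of X f] assms is_beta_extension_restrict by (fastforce simp: carrier_CB)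
  then show ?thesis
    unfolding beta_extension_def using beta_extension_unique by (metis theI)
qed

lemma beta_extension_complex:
  assumes "f \<in> carrier (CB X :: ('a \<Rightarrow> complex) ring)"
  shows "is_beta_extension X f (beta_extension X f)"
proof -
  have f: "continuous_map X euclidean f" and bf: "bounded (f ` topspace X)"
    using assms by (auto simp: carrier_CB)
  obtain B where B: "\<And>x. x \<in> topspace X \<Longrightarrow> cmod (f x) \<le> B"
    using bf unfolding bounded_iff by auto
  have 1: "continuous_map X euclidean (\<lambda>x. Re (f x))" "continuous_map X euclidean (\<lambda>x. Im (f x))"
    using f unfolding continuous_map_atin by (auto intro: tendsto_intros)
  have "\<bar>Re (f x)\<bar> \<le> B" "\<bar>Im (f x)\<bar> \<le> B" if "x \<in> topspace X" for x
    using B[OF that] abs_Re_le_cmod[of "f x"] abs_Im_le_cmod[of "f x"] by linarith+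
  then have 2: "bounded ((\<lambda>x. Re (f x)) ` topspace X)" "bounded ((\<lambda>x. Im (f x)) ` topspace X)"
    unfolding bounded_iff by auto
  obtain U V where U: "continuous_map (beta X) euclidean U" "\<forall>x\<in>topspace X. U (beta_embed X x) = Re (f x)"
    and V: "continuous_map (beta X) euclidean V" "\<forall>x\<in>topspace X. V (beta_embed X x) = Im (f x)"
    using ex_extension_real[OF 1(1) 2(1)] ex_extension_real[OF 1(2) 2(2)] by blast
  have "continuous_map (beta X) euclidean (\<lambda>z. Complex (U z) (V z))"
    using U V unfolding continuous_map_atin by (auto intro: tendsto_intros)
  then obtain F where "is_beta_extension X f F"
    using is_beta_extension_restrict[of X "\<lambda>z. Complex (U z) (V z)" f] U V by auto
  then show ?thesis
    unfolding beta_extension_def using beta_extension_unique by (metis theI)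
qed

lemma CB_norm_sup:
  fixes f :: "'a \<Rightarrow> 'f::real_normed_field"
  assumes "f \<in> carrier (CB X)" "topspace X \<noteq> {}"
  shows "CB_norm X f = (SUP x\<in>topspace X. norm (f x))"
proof -
  interpret cring "CB X :: ('a \<Rightarrow> 'f) ring" by (rule cring_CB)
  show ?thesis
  using assms zero_closed unfolding CB_norm_def CB_metric_def mdist_cfunspace_eq_mdist_funspace
  by (auto simp: Met_TC.fdist_def Met_TC.fspace_def CB_simps carrier_CB intro!: SUP_cong)
qed


lemma CB_minus:
  fixes f g :: "'a \<Rightarrow> 'f::real_normed_field"
  assumes "f \<in> carrier (CB X)" "g \<in> carrier (CB X)"
  shows "\<ominus>\<^bsub>CB X\<^esub> g = (\<lambda>x\<in>topspace X. - g x)" "f \<ominus>\<^bsub>CB X\<^esub> g = (\<lambda>x\<in>topspace X. f x - g x)"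
proof -
  interpret cring "CB X :: ('a \<Rightarrow> 'f) ring" by (rule cring_CB)
  have "(\<lambda>x\<in>topspace X. - g x) \<in> carrier (CB X)"
    using assms by (auto simp: carrier_CB continuous_map_restrict_iff continuous_map_field_ops bounded_image_field_ops cong: image_cong)
  moreover have "(\<lambda>x\<in>topspace X. - g x) \<oplus>\<^bsub>CB X\<^esub> g = \<zero>\<^bsub>CB X\<^esub>"
    by (auto simp: CB_simps)
  ultimately show *: "\<ominus>\<^bsub>CB X\<^esub> g = (\<lambda>x\<in>topspace X. - g x)"
    using assms by (metis minus_equality)
  show "f \<ominus>\<^bsub>CB X\<^esub> g = (\<lambda>x\<in>topspace X. f x - g x)"
    unfolding a_minus_def * by (auto simp: CB_simps)
qed

lemma CB_dist:
  fixes f g :: "'a \<Rightarrow> 'f::real_normed_field"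
  assumes "f \<in> carrier (CB X)" "g \<in> carrier (CB X)"
  shows "mdist (CB_metric X) f g = CB_norm X (f \<ominus>\<^bsub>CB X\<^esub> g)"
proof (cases "topspace X = {}")
  case True
  then show ?thesis unfolding CB_norm_def CB_metric_def mdist_cfunspace_eq_mdist_funspace
    by (simp add: Met_TC.fdist_empty)
next
  case False
  interpret cring "CB X :: ('a \<Rightarrow> 'f) ring" by (rule cring_CB)
  have "mdist (CB_metric X) f g = (SUP x\<in>topspace X. dist (f x) (g x))"
    using assms False unfolding CB_metric_def mdist_cfunspace_eq_mdist_funspace
    by (auto simp: Met_TC.fdist_def Met_TC.fspace_def carrier_CB)
  also have "\<dots> = CB_norm X (f \<ominus>\<^bsub>CB X\<^esub> g)"
    using CB_norm_sup[OF minus_closed[OF assms] False] by (simp add: CB_minus[OF assms] dist_norm)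
  finally show ?thesis .
qed

lemma quotient_metric:
  fixes G :: "('a \<Rightarrow> 'f::real_normed_field) set"
  assumes "closed_ideal X G"
  shows "Metric_space (carrier (CB X Quot G)) (quot_dist X G)"
proof -
  let ?R = "CB X :: ('a \<Rightarrow> 'f) ring" and ?Q = "CB X Quot G"
  interpret R: cring ?R by (rule cring_CB)
  interpret I: ideal G ?R using assms by (simp add: closed_ideal_def)
  interpret Q: ring ?Q by (rule I.quotient_is_ring)
  interpret M: Metric_space "carrier ?R" "mdist (CB_metric X)"
    using Metric_space_mspace_mdist[of "CB_metric X"] by (simp add: CB_def)
  have N0: "0 \<le> CB_norm X f" for f :: "'a \<Rightarrow> 'f" by (simp add: CB_norm_def)
  have Nm: "CB_norm X (\<ominus>\<^bsub>?R\<^esub> f) = CB_norm X f" if "f \<in> carrier ?R" for f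
  proof -
    have "CB_norm X (\<ominus>\<^bsub>?R\<^esub> f) = mdist (CB_metric X) \<zero>\<^bsub>?R\<^esub> f"
      using CB_dist[of "\<zero>\<^bsub>?R\<^esub>" X f] that by (simp add: a_minus_def)
    then show ?thesis by (simp add: CB_norm_def M.commute)
  qed
  have Nt: "CB_norm X (f \<oplus>\<^bsub>?R\<^esub> g) \<le> CB_norm X f + CB_norm X g"
    if "f \<in> carrier ?R" "g \<in> carrier ?R" for f g
  proof -
    have "CB_norm X (f \<oplus>\<^bsub>?R\<^esub> g) = mdist (CB_metric X) f (\<ominus>\<^bsub>?R\<^esub> g)"
      using CB_dist[of f X "\<ominus>\<^bsub>?R\<^esub> g"] that by (simp add: a_minus_def)
    also have "\<dots> \<le> CB_norm X f + CB_norm X (\<ominus>\<^bsub>?R\<^esub> g)"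
      using M.triangle[of f "\<zero>\<^bsub>?R\<^esub>" "\<ominus>\<^bsub>?R\<^esub> g"] that by (simp add: CB_norm_def M.commute)
    finally show ?thesis using Nm that by simp
  qed
  have rep: "\<exists>x\<in>carrier ?R. K = G +>\<^bsub>?R\<^esub> x" if "K \<in> carrier ?Q" for K
    using that by (auto simp: FactRing_def A_RCOSETS_def')
  have ne: "K \<noteq> {}" and sub: "K \<subseteq> carrier ?R" if "K \<in> carrier ?Q" for K
    using rep[OF that] I.a_rcos_self R.a_r_coset_subset_G I.a_subset by (blast, blast)
  have bdd: "bdd_below (CB_norm X ` K)" for K :: "('a \<Rightarrow> 'f) set"
    using N0 by (auto simp: bdd_below_def)
  have q0: "0 \<le> quot_norm X K" if "K \<in> carrier ?Q" for K
    unfolding quot_norm_def using ne[OF that] N0 by (auto intro: cINF_greatest)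
  have addQ: "f \<oplus>\<^bsub>?R\<^esub> g \<in> A \<oplus>\<^bsub>?Q\<^esub> B" if "f \<in> A" "g \<in> B" for f g A B
    using that by (auto simp: FactRing_def set_add_def')
  have tri: "quot_norm X (A \<oplus>\<^bsub>?Q\<^esub> B) \<le> quot_norm X A + quot_norm X B"
    if A: "A \<in> carrier ?Q" and B: "B \<in> carrier ?Q" for A B
  proof -
    have *: "quot_norm X (A \<oplus>\<^bsub>?Q\<^esub> B) \<le> CB_norm X f + CB_norm X g" if "f \<in> A" "g \<in> B" for f g
      unfolding quot_norm_def
      using cINF_lower[OF bdd addQ[OF that]] Nt[of f g] sub[OF A] sub[OF B] that by force
    have **: "quot_norm X (A \<oplus>\<^bsub>?Q\<^esub> B) - CB_norm X f \<le> quot_norm X B" if "f \<in> A" for f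
      unfolding quot_norm_def[of X B]
    proof (rule cINF_greatest[OF ne[OF B]])
      fix g assume "g \<in> B"
      then show "quot_norm X (A \<oplus>\<^bsub>?Q\<^esub> B) - CB_norm X f \<le> CB_norm X g" using *[OF that] by force
    qed
    have "quot_norm X (A \<oplus>\<^bsub>?Q\<^esub> B) - quot_norm X B \<le> quot_norm X A"
      unfolding quot_norm_def[of X A]
    proof (rule cINF_greatest[OF ne[OF A]])
      fix f assume "f \<in> A"
      then show "quot_norm X (A \<oplus>\<^bsub>?Q\<^esub> B) - quot_norm X B \<le> CB_norm X f" using **[of f] by force
    qed
    then show ?thesis by simp
  qed
  have negQ: "\<ominus>\<^bsub>?Q\<^esub> K = (\<lambda>f. \<ominus>\<^bsub>?R\<^esub> f) ` K" if K: "K \<in> carrier ?Q" for K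
  proof -
    obtain x where x: "x \<in> carrier ?R" "K = G +>\<^bsub>?R\<^esub> x" using rep K by blast
    have *: "\<ominus>\<^bsub>?Q\<^esub> K = G +>\<^bsub>?R\<^esub> (\<ominus>\<^bsub>?R\<^esub> x)"
    proof (rule Q.minus_equality)
      show "(G +>\<^bsub>?R\<^esub> (\<ominus>\<^bsub>?R\<^esub> x)) \<oplus>\<^bsub>?Q\<^esub> K = \<zero>\<^bsub>?Q\<^esub>"
        using x by (simp add: FactRing_def I.a_rcos_sum R.l_neg I.a_subset)
    qed (use x K in \<open>auto simp: FactRing_def A_RCOSETS_def'\<close>)
    have n1: "\<ominus>\<^bsub>?R\<^esub> (h \<oplus>\<^bsub>?R\<^esub> x) \<in> G +>\<^bsub>?R\<^esub> (\<ominus>\<^bsub>?R\<^esub> x)" if "h \<in> G" for h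
      using that x I.a_Hcarr[OF that] I.a_inv_closed[OF that]
      unfolding a_r_coset_def' by (intro UN_I[of "\<ominus>\<^bsub>?R\<^esub> h"]) (simp_all add: R.minus_add)
    have n2: "h \<oplus>\<^bsub>?R\<^esub> \<ominus>\<^bsub>?R\<^esub> x \<in> (\<lambda>f. \<ominus>\<^bsub>?R\<^esub> f) ` (G +>\<^bsub>?R\<^esub> x)" if "h \<in> G" for h
    proof
      show "h \<oplus>\<^bsub>?R\<^esub> \<ominus>\<^bsub>?R\<^esub> x = \<ominus>\<^bsub>?R\<^esub> (\<ominus>\<^bsub>?R\<^esub> h \<oplus>\<^bsub>?R\<^esub> x)"
        using that x I.a_Hcarr[OF that] by (simp add: R.minus_add)
      show "\<ominus>\<^bsub>?R\<^esub> h \<oplus>\<^bsub>?R\<^esub> x \<in> G +>\<^bsub>?R\<^esub> x"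
        using I.a_inv_closed[OF that] by (auto simp: a_r_coset_def')
    qed
    have k1: "K = (\<lambda>h. h \<oplus>\<^bsub>?R\<^esub> x) ` G" unfolding x(2) by (auto simp: a_r_coset_def')
    have k2: "\<ominus>\<^bsub>?Q\<^esub> K = (\<lambda>h. h \<oplus>\<^bsub>?R\<^esub> \<ominus>\<^bsub>?R\<^esub> x) ` G" unfolding * by (auto simp: a_r_coset_def')
    show ?thesis
    proof (intro equalityI subsetI)
      fix y assume "y \<in> \<ominus>\<^bsub>?Q\<^esub> K"
      then obtain h where "h \<in> G" "y = h \<oplus>\<^bsub>?R\<^esub> \<ominus>\<^bsub>?R\<^esub> x" unfolding k2 by (rule imageE)
      then show "y \<in> (\<lambda>f. \<ominus>\<^bsub>?R\<^esub> f) ` K" using n2[of h] x(2) by simp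
    next
      fix y assume "y \<in> (\<lambda>f. \<ominus>\<^bsub>?R\<^esub> f) ` K"
      then obtain h where "h \<in> G" "y = \<ominus>\<^bsub>?R\<^esub> (h \<oplus>\<^bsub>?R\<^esub> x)" unfolding k1 image_image by (rule imageE)
      then show "y \<in> \<ominus>\<^bsub>?Q\<^esub> K" using n1[of h] * by simp
    qed
  qed
  have qm: "quot_norm X (\<ominus>\<^bsub>?Q\<^esub> K) = quot_norm X K" if K: "K \<in> carrier ?Q" for K
    unfolding quot_norm_def negQ[OF K] image_image
    using Nm sub[OF K] by (intro INF_cong) auto
  have z: "K = G" if K: "K \<in> carrier ?Q" and 0: "quot_norm X K = 0" for K
  proof -
    obtain x where x: "x \<in> carrier ?R" "K = G +>\<^bsub>?R\<^esub> x" using rep K by blast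
    have "\<exists>g\<in>G. mdist (CB_metric X) x g < e" if "e > 0" for e
    proof -
      obtain k where k: "k \<in> K" "CB_norm X k < e"
        using 0 cINF_less_iff[OF ne[OF K] bdd[of K], of e] \<open>e>0\<close> unfolding quot_norm_def by auto
      obtain h where h: "h \<in> G" "k = h \<oplus>\<^bsub>?R\<^esub> x" using k(1) x by (auto simp: a_r_coset_def')
      have "k = x \<ominus>\<^bsub>?R\<^esub> (\<ominus>\<^bsub>?R\<^esub> h)" using h x I.a_Hcarr by (simp add: a_minus_def R.a_comm)
      then show ?thesis using CB_dist[of x X "\<ominus>\<^bsub>?R\<^esub> h"] k h x I.a_Hcarr I.a_inv_closed
        by (intro bexI[of _ "\<ominus>\<^bsub>?R\<^esub> h"]) simp_all
    qed
    then have "x \<in> mtopology_of (CB_metric X) closure_of G"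
      using x I.a_subset unfolding mtopology_of_def Metric_space.metric_closure_of[OF Metric_space_mspace_mdist]
        Metric_space.in_mball[OF Metric_space_mspace_mdist] by (simp add: CB_def) blast
    then have "x \<in> G" using assms by (simp add: closed_ideal_def closure_of_closedin)
    then show ?thesis using x R.a_coset_join2[OF _ I.a_subgroup] by simp
  qed
  have zG: "\<zero>\<^bsub>?Q\<^esub> = G" by (simp add: FactRing_def)
  have zz: "quot_norm X G = 0"
  proof (rule antisym)
    have "quot_norm X G \<le> CB_norm X \<zero>\<^bsub>?R\<^esub>" unfolding quot_norm_def by (rule cINF_lower[OF bdd]) simp
    then show "quot_norm X G \<le> 0" by (simp add: CB_norm_def)
    show "0 \<le> quot_norm X G" using q0[of G] zG Q.zero_closed by simp
  qed
  have dsym: "quot_norm X (A \<ominus>\<^bsub>?Q\<^esub> B) = quot_norm X (B \<ominus>\<^bsub>?Q\<^esub> A)"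
    if "A \<in> carrier ?Q" "B \<in> carrier ?Q" for A B
  proof -
    have "\<ominus>\<^bsub>?Q\<^esub> (B \<ominus>\<^bsub>?Q\<^esub> A) = A \<ominus>\<^bsub>?Q\<^esub> B"
      using that by (simp add: a_minus_def Q.minus_add Q.a_comm)
    then show ?thesis using qm[of "B \<ominus>\<^bsub>?Q\<^esub> A"] that by simp
  qed
  show ?thesis
  proof
    show "0 \<le> quot_dist X G A B" for A B
      using q0 by (simp add: quot_dist_def)
    show "quot_dist X G A B = quot_dist X G B A" for A B
      using dsym by (simp add: quot_dist_def)
    show "quot_dist X G A B = 0 \<longleftrightarrow> A = B" if "A \<in> carrier ?Q" "B \<in> carrier ?Q" for A B
    proof -
      have "(A \<ominus>\<^bsub>?Q\<^esub> B) \<oplus>\<^bsub>?Q\<^esub> B = A"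
        using that by (simp add: a_minus_def Q.a_assoc Q.l_neg)
      moreover have "A \<ominus>\<^bsub>?Q\<^esub> A = G" using that zG by (simp add: a_minus_def Q.r_neg)
      moreover have "G \<oplus>\<^bsub>?Q\<^esub> B = B" using Q.l_zero[OF that(2)] by (simp add: zG)
      ultimately show ?thesis using z[of "A \<ominus>\<^bsub>?Q\<^esub> B"] zz that by (auto simp: quot_dist_def)
    qed
    show "quot_dist X G A C \<le> quot_dist X G A B + quot_dist X G B C"
      if "A \<in> carrier ?Q" "B \<in> carrier ?Q" "C \<in> carrier ?Q" for A B C
    proof -
      have "A \<ominus>\<^bsub>?Q\<^esub> C = (A \<ominus>\<^bsub>?Q\<^esub> B) \<oplus>\<^bsub>?Q\<^esub> (B \<ominus>\<^bsub>?Q\<^esub> C)"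
        using that by (simp add: a_minus_def Q.a_assoc Q.r_neg1)
      then show ?thesis using tri[of "A \<ominus>\<^bsub>?Q\<^esub> B" "B \<ominus>\<^bsub>?Q\<^esub> C"] that by (simp add: quot_dist_def)
    qed
  qed
qed

end

theory Submission
  imports Defs
begin

text \<open>
  Write \<open>\<beta>X\<close> for the Stone-Cech compactification, and regard \<open>X\<close> as a subspace of it.

  The spectrum of \<open>H\<close> enters only through the inclusions \<open>X \<subseteq> sp(H) \<subseteq> \<beta>X\<close>: the first one says that
  \<open>H\<close> is non-vanishing. Bounded functions on \<open>X\<close> extend to every space in between, and so do
  the indicators of clopen sets, so \<open>sp(H)\<close> and \<open>X\<close> are strongly zero-dimensional together
  (\<open>strongly_zero_dimensional_between_beta\<close>).

  Idempotents of the ring are the indicators of clopen sets. If \<open>X\<close> is strongly zero-dimensional,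
  every \<open>g\<close> is approximated by its restrictions to clopen sets \<open>U\<close> on which it is bounded away
  from \<open>0\<close>, and the indicator of such a \<open>U\<close> is a multiple of \<open>g\<close> (\<open>clopen_truncation\<close>). This shows at
  once that closed ideals are generated by their idempotents, and that a non-zero quotient
  by a closed ideal is either split by an idempotent or a field (\<open>quotient_alternative\<close>).

  For the converses, suitable closed ideals consist of the functions whose extensions vanish on
  a set \<open>C \<subseteq> \<beta>X\<close>. If they are generated by idempotents, take \<open>C\<close> to be the zero set in \<open>X\<close> of a
  unit-valued function \<open>f\<close>: an element of the ideal generated by idempotents that is close
  to \<open>f\<close> is carried by a clopen set, which separates \<open>{f = 0}\<close> from \<open>{f = 1}\<close>. In the case of
  quotients, take \<open>C\<close> connected. The quotient then consists of functions on \<open>C\<close>, and a dense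
  sum of two non-zero ideals with zero intersection would disconnect \<open>C\<close>; hence the extension of \<open>f\<close>
  cannot take both values \<open>0\<close> and \<open>1\<close> on \<open>C\<close>, as the quotient would be neither zero nor simple.
  Since components and quasi-components agree in compact Hausdorff spaces, the sets \<open>{f = 0}\<close> and
  \<open>{f = 1}\<close> in \<open>\<beta>X\<close> are then separated by a clopen set.
\<close>

section \<open>Bounded continuous functions and indicators of clopen sets\<close>

lemma mspace_CB_metric: "mspace (CB_metric X) = carrier (CB X)"
  by (simp add: CB_def)

lemma CB_restrictI:
  fixes f :: "'a \<Rightarrow> 'f::real_normed_field"
  assumes "continuous_map X euclidean f" "\<And>x. x \<in> topspace X \<Longrightarrow> norm (f x) \<le> B"
  shows "(\<lambda>x\<in>topspace X. f x) \<in> carrier (CB X)"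
  using assms by (auto simp: carrier_CB continuous_map_restrict_iff bounded_iff)

lemma CB_continuous: "f \<in> carrier (CB X) \<Longrightarrow> continuous_map X euclidean f"
  by (simp add: carrier_CB)

lemma mdist_CB_le:
  assumes "0 \<le> e" "\<And>x. x \<in> topspace X \<Longrightarrow> norm (f x - g x) \<le> e"
  shows "mdist (CB_metric X) f g \<le> e"
  using assms unfolding CB_metric_def by (intro mdist_cfunspace_le) (auto simp: dist_norm)

lemma norm_diff_le_mdist:
  assumes "f \<in> carrier (CB X)" "g \<in> carrier (CB X)" "x \<in> topspace X"
  shows "norm (f x - g x) \<le> mdist (CB_metric X) f g"
  using mdist_cfunspace_imp_mdist_le[of f X euclidean_metric g "mdist (CB_metric X) f g" x] assms
  by (simp add: CB_metric_def CB_def dist_norm)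

lemma norm_le_CB_norm:
  fixes f :: "'a \<Rightarrow> 'f::real_normed_field"
  assumes "f \<in> carrier (CB X)" "x \<in> topspace X"
  shows "norm (f x) \<le> CB_norm X f"
proof -
  interpret R: cring "CB X :: ('a \<Rightarrow> 'f) ring" by (rule cring_CB)
  show ?thesis
    using norm_diff_le_mdist[OF assms(1) R.zero_closed assms(2)] assms(2)
    by (simp add: CB_norm_def CB_simps)
qed

lemma in_CB_closure_iff:
  "f \<in> CB_closure X A \<longleftrightarrow>
     f \<in> carrier (CB X) \<and> (\<forall>e>0. \<exists>g\<in>A. g \<in> carrier (CB X) \<and> mdist (CB_metric X) f g < e)"
  unfolding mtopology_of_def Metric_space.metric_closure_of[OF Metric_space_mspace_mdist]
    Metric_space.in_mball[OF Metric_space_mspace_mdist]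
  unfolding mspace_CB_metric
  by auto

lemma continuous_map_field_inverse:
  fixes f :: "'a \<Rightarrow> 'f::real_normed_field"
  assumes "continuous_map X euclidean f" "\<And>x. x \<in> topspace X \<Longrightarrow> f x \<noteq> 0"
  shows "continuous_map X euclidean (\<lambda>x. inverse (f x))"
  using assms by (simp add: continuous_map_atin tendsto_inverse)

definition clopen_indicator :: "'a topology \<Rightarrow> 'a set \<Rightarrow> 'a \<Rightarrow> 'f::real_normed_field"
  where "clopen_indicator X U = (\<lambda>x\<in>topspace X. if x \<in> U then 1 else 0)"

lemma continuous_map_indicator:
  fixes a b :: "'f::real_normed_field"
  assumes "openin X U" "closedin X U"
  shows "continuous_map X euclidean (\<lambda>x. if x \<in> U then a else b)"
  unfolding continuous_map
proof (intro conjI allI impI)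
  fix V :: "'f set"
  have c: "openin X (topspace X - U)" "topspace X \<inter> U = U"
    using assms openin_subset by (auto simp: closedin_def)
  have "{x \<in> topspace X. (if x \<in> U then a else b) \<in> V} =
      (if a \<in> V then U else {}) \<union> (if b \<in> V then topspace X - U else {})"
    using c by auto
  then show "openin X {x \<in> topspace X. (if x \<in> U then a else b) \<in> V}"
    using assms c by auto
qed auto

lemma clopen_indicator_CB:
  assumes "openin X U" "closedin X U"
  shows "clopen_indicator X U \<in> carrier (CB X)"
  unfolding clopen_indicator_def
  by (rule CB_restrictI[where B = 1]) (use continuous_map_indicator[OF assms] in auto)

text \<open>
  The indicators of a clopen set and of its complement are complementary orthogonal idempotents;
  they are what splits the ring, and later its quotients.
\<close>

lemma clopen_indicator_idem:
  "clopen_indicator X U \<otimes>\<^bsub>CB X\<^esub> clopen_indicator X U = clopen_indicator X U"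
  by (auto simp: CB_simps clopen_indicator_def)

lemma clopen_indicator_compl:
  "clopen_indicator X U \<oplus>\<^bsub>CB X\<^esub> clopen_indicator X (topspace X - U) = \<one>\<^bsub>CB X\<^esub>"
  by (auto simp: CB_simps clopen_indicator_def)

lemma clopen_indicator_orth:
  "clopen_indicator X U \<otimes>\<^bsub>CB X\<^esub> clopen_indicator X (topspace X - U) = \<zero>\<^bsub>CB X\<^esub>"
  by (auto simp: CB_simps clopen_indicator_def)

text \<open>
  An idempotent takes only the values \<open>0\<close> and \<open>1\<close>, so its support is at once the preimage of the
  open set \<open>- {0}\<close> and of the closed set \<open>{1}\<close>.
\<close>

lemma idempotent_support_clopen:
  fixes g :: "'a \<Rightarrow> 'f::real_normed_field"
  assumes g: "g \<in> carrier (CB X)" and idem: "g \<otimes>\<^bsub>CB X\<^esub> g = g"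
  shows "openin X {x \<in> topspace X. g x \<noteq> 0}" "closedin X {x \<in> topspace X. g x \<noteq> 0}"
proof -
  have *: "g x = 0 \<or> g x = 1" if "x \<in> topspace X" for x
    using fun_cong[OF idem, of x] that by (simp add: CB_simps)
  then have eq: "{x \<in> topspace X. g x \<noteq> 0} = {x \<in> topspace X. g x \<in> {1}}" by force
  show "openin X {x \<in> topspace X. g x \<noteq> 0}"
    using openin_continuous_map_preimage[OF CB_continuous[OF g], of "- {0}"]
    by (simp add: open_Compl)
  show "closedin X {x \<in> topspace X. g x \<noteq> 0}"
    unfolding eq by (rule closedin_continuous_map_preimage[OF CB_continuous[OF g]]) simp
qed


section \<open>Ideals and quotients of commutative rings\<close>

text \<open>
  Closure under multiplication by \<open>- 1\<close> supplies the additive inverses, so they need not be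
  checked in each of the function ideals below.
\<close>

lemma (in cring) idealI_cring:
  assumes sub: "J \<subseteq> carrier R" and zero: "\<zero> \<in> J"
    and add: "\<And>a b. a \<in> J \<Longrightarrow> b \<in> J \<Longrightarrow> a \<oplus> b \<in> J"
    and mult: "\<And>a r. a \<in> J \<Longrightarrow> r \<in> carrier R \<Longrightarrow> r \<otimes> a \<in> J"
  shows "ideal J R"
proof (rule idealI[OF ring_axioms])
  show "subgroup J (add_monoid R)"
  proof (rule subgroup.intro)
    fix a assume a: "a \<in> J"
    then have "\<ominus> a = (\<ominus> \<one>) \<otimes> a" using sub by (auto simp: l_minus)
    then have "\<ominus> a \<in> J" using mult[OF a, of "\<ominus> \<one>"] by simp
    then show "inv\<^bsub>add_monoid R\<^esub> a \<in> J" by (simp add: a_inv_def)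
  qed (use assms in auto)
  show "x \<otimes> a \<in> J" "a \<otimes> x \<in> J" if "a \<in> J" "x \<in> carrier R" for a x
    using mult[OF that] m_comm[of a x] sub that by auto
qed

lemma (in ideal) coset_eq_zero_iff:
  assumes "x \<in> carrier R"
  shows "I +> x = \<zero>\<^bsub>R Quot I\<^esub> \<longleftrightarrow> x \<in> I"
proof -
  have "\<zero>\<^bsub>R Quot I\<^esub> = I" by (simp add: FactRing_def)
  then show ?thesis using rcos_const_imp_mem[OF assms] a_rcos_zero[OF is_ideal] by metis
qed

lemma (in ideal) ex_coset_rep:
  assumes "K \<in> carrier (R Quot I)"
  shows "\<exists>x\<in>carrier R. K = I +> x"
  using assms by (auto simp: FactRing_def A_RCOSETS_def')

text \<open>
  Multiplication by \<open>1 = e + f\<close> splits every element into its components in the two principal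
  ideals, and an element of both is annihilated by \<open>e\<close> and by \<open>f\<close>, hence by \<open>1\<close>.
\<close>

lemma (in cring) carrier_decomposable:
  assumes e: "e \<in> carrier R" "e \<noteq> \<zero>" and f: "f \<in> carrier R" "f \<noteq> \<zero>"
    and sum: "e \<oplus> f = \<one>" and orth: "e \<otimes> f = \<zero>"
  shows "decomposable_ideal R (carrier R)"
proof -
  have "PIdl e \<inter> PIdl f = {\<zero>}"
  proof -
    have "z = \<zero>" if z: "z \<in> PIdl e" "z \<in> PIdl f" for z
    proof -
      obtain x y where x: "x \<in> carrier R" "z = x \<otimes> e" and y: "y \<in> carrier R" "z = y \<otimes> f"
        using z unfolding cgenideal_def by blast
      have "z \<otimes> f = \<zero>" using x e f orth by (simp add: m_assoc)
      moreover have "z \<otimes> e = \<zero>" using y e f orth by (simp add: m_assoc m_comm[of f e])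
      moreover have "z = z \<otimes> (e \<oplus> f)" using x e(1) sum by simp
      ultimately show ?thesis using x e(1) f(1) by (simp add: r_distr)
    qed
    moreover have "\<zero> \<in> PIdl e" "\<zero> \<in> PIdl f"
      using additive_subgroup.zero_closed ideal.axioms(1) cgenideal_ideal e(1) f(1) by blast+
    ultimately show ?thesis by blast
  qed
  moreover have "PIdl e <+>\<^bsub>R\<^esub> PIdl f = carrier R"
  proof
    show "PIdl e <+>\<^bsub>R\<^esub> PIdl f \<subseteq> carrier R"
      using ideal.Icarr[OF add_ideals[OF cgenideal_ideal[OF e(1)] cgenideal_ideal[OF f(1)]]] by blast
    show "carrier R \<subseteq> PIdl e <+>\<^bsub>R\<^esub> PIdl f"
    proof
      fix x assume x: "x \<in> carrier R"
      then have "x = x \<otimes> e \<oplus> x \<otimes> f"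
        using e(1) f(1) sum r_one[OF x] by (simp flip: r_distr)
      then show "x \<in> PIdl e <+>\<^bsub>R\<^esub> PIdl f"
        using x unfolding set_add_def' cgenideal_def by blast
    qed
  qed
  moreover have "PIdl e \<noteq> {\<zero>}" "PIdl f \<noteq> {\<zero>}"
    using cgenideal_self[OF e(1)] cgenideal_self[OF f(1)] e f by blast+
  ultimately show ?thesis
    unfolding decomposable_ideal_def using cgenideal_ideal e(1) f(1) by blast
qed

lemma (in cring) simple_if_nonzero_invertible:
  assumes "carrier R \<noteq> {\<zero>}" and inv: "\<And>x. x \<in> carrier R \<Longrightarrow> x \<noteq> \<zero> \<Longrightarrow> \<exists>y\<in>carrier R. y \<otimes> x = \<one>"
  shows "simple_ideal R (carrier R)"
  unfolding simple_ideal_def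
proof (intro conjI allI impI)
  fix I assume I: "ideal I R \<and> I \<subseteq> carrier R"
  then interpret I: ideal I R by simp
  show "I = {\<zero>} \<or> I = carrier R"
  proof (cases "I = {\<zero>}")
    case False
    then obtain x where x: "x \<in> I" "x \<noteq> \<zero>" using I.zero_closed by blast
    then obtain y where "y \<in> carrier R" "y \<otimes> x = \<one>" using inv I.Icarr by blast
    then have "\<one> \<in> I" using I.I_l_closed[OF x(1)] by metis
    then show ?thesis using I.one_imp_carrier by blast
  qed simp
qed (use assms oneideal in auto)

section \<open>Spaces between X and its Stone-Cech compactification\<close>

text \<open>
  It suffices to separate the sets where a function is \<open>0\<close> and where it is \<open>1\<close>, since these contain
  any two sets that the function completely separates. The reformulation gives access to the
  calculus of \<^const>\<open>separated_between\<close>.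
\<close>

lemma strongly_zero_dimensional_iff_separated_between:
  "strongly_zero_dimensional Y \<longleftrightarrow>
     completely_regular_space Y \<and> Hausdorff_space Y \<and>
     (\<forall>f. continuous_map Y (top_of_set {0..1::real}) f \<longrightarrow>
        separated_between Y {x \<in> topspace Y. f x = 0} {x \<in> topspace Y. f x = 1})"
  (is "?L \<longleftrightarrow> ?R")
proof
  assume L: ?L
  have "separated_between Y {x \<in> topspace Y. f x = 0} {x \<in> topspace Y. f x = 1}"
    if f: "continuous_map Y (top_of_set {0..1::real}) f" for f
  proof -
    have "completely_separated Y {x \<in> topspace Y. f x = 0} {x \<in> topspace Y. f x = 1}"
      unfolding completely_separated_def using f by blast
    then obtain U V where "openin Y U" "closedin Y U" "disjnt U V"
      "{x \<in> topspace Y. f x = 0} \<subseteq> U" "{x \<in> topspace Y. f x = 1} \<subseteq> V"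
      using L unfolding strongly_zero_dimensional_def by blast
    then show ?thesis unfolding separated_between disjnt_def by blast
  qed
  then show ?R using L by (simp add: strongly_zero_dimensional_def)
next
  assume R: ?R
  have "\<exists>U V. openin Y U \<and> closedin Y U \<and> openin Y V \<and> closedin Y V \<and>
              disjnt U V \<and> A \<subseteq> U \<and> B \<subseteq> V" if AB: "completely_separated Y A B" for A B
  proof -
    obtain f where f: "continuous_map Y (top_of_set {0..1::real}) f"
      "A \<subseteq> {x \<in> topspace Y. f x = 0}" "B \<subseteq> {x \<in> topspace Y. f x = 1}"
      using AB unfolding completely_separated_def by blast
    then have "separated_between Y A B"
      using R separated_between_mono by blast
    then obtain U where "openin Y U" "closedin Y U" "A \<subseteq> U" "B \<subseteq> topspace Y - U"
      unfolding separated_between by blast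
    then show ?thesis
      by (intro exI[of _ U] exI[of _ "topspace Y - U"]) (auto simp: disjnt_def)
  qed
  then show ?L using R by (simp add: strongly_zero_dimensional_def)
qed

text \<open>
  Rescaling and clamping turns the levels \<open>a < b\<close> into the levels \<open>0 < 1\<close> of a function into the
  unit interval.
\<close>

lemma separated_levels:
  assumes szd: "strongly_zero_dimensional Y" and f: "continuous_map Y euclideanreal f" and ab: "a < b"
  obtains U where "openin Y U" "closedin Y U"
    "\<And>x. x \<in> topspace Y \<Longrightarrow> f x \<le> a \<Longrightarrow> x \<notin> U" "\<And>x. x \<in> topspace Y \<Longrightarrow> b \<le> f x \<Longrightarrow> x \<in> U"
proof -
  define t where "t x = max 0 (min 1 ((f x - a) / (b - a)))" for x
  have "continuous_map Y euclideanreal t"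
    unfolding t_def using f ab by (intro continuous_intros) auto
  then have "continuous_map Y (top_of_set {0..1}) t"
    by (auto simp: continuous_map_in_subtopology t_def)
  then have "separated_between Y {x \<in> topspace Y. t x = 1} {x \<in> topspace Y. t x = 0}"
    using szd strongly_zero_dimensional_iff_separated_between separated_between_sym by blast
  then obtain U where U: "openin Y U" "closedin Y U" "{x \<in> topspace Y. t x = 1} \<subseteq> U"
    "{x \<in> topspace Y. t x = 0} \<subseteq> topspace Y - U"
    unfolding separated_between by blast
  have "t x = 0" if "f x \<le> a" for x
    using that ab by (simp add: t_def max_def min_def divide_simps)
  moreover have "t x = 1" if "b \<le> f x" for x
    using that ab by (simp add: t_def max_def min_def divide_simps)
  ultimately show thesis using that[of U] U by blast
qed

lemma continuous_beta_embed:
  assumes "completely_regular_space X" "Hausdorff_space X"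
  shows "continuous_map X (beta X) (beta_embed X)"
  using embedding_beta[OF assms] continuous_map_in_subtopology
  unfolding embedding_map_def homeomorphic_eq_everything_map by blast

text \<open>
  A space \<open>Y\<close> with \<open>X \<subseteq> Y \<subseteq> \<beta>X\<close> has the same bounded functions as \<open>X\<close>, up to restriction and extension.
  From \<open>Y\<close> to \<open>X\<close>: a unit-valued function on \<open>X\<close> extends to \<open>Y\<close>, and a clopen set that separates
  its levels there is restricted to \<open>X\<close>. From \<open>X\<close> to \<open>Y\<close>: the indicator of a clopen subset of \<open>X\<close>
  extends to \<open>\<beta>X\<close>, and since \<open>X\<close> is dense in \<open>Y\<close> the extension is still an indicator and still
  separates the levels of the given function.
\<close>

lemma strongly_zero_dimensional_between_beta:
  assumes X: "completely_regular_space X" "Hausdorff_space X"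
    and S: "S \<subseteq> topspace (beta X)" "beta_embed X ` topspace X \<subseteq> S"
  shows "strongly_zero_dimensional (subtopology (beta X) S) \<longleftrightarrow> strongly_zero_dimensional X"
    (is "strongly_zero_dimensional ?Y \<longleftrightarrow> _")
proof
  have cb: "continuous_map X ?Y (beta_embed X)"
    using continuous_beta_embed[OF X] S by (auto simp: continuous_map_in_subtopology)
  have tY: "topspace ?Y = S" using S by auto
  have dense: "y \<in> ?Y closure_of (beta_embed X ` topspace X)" if "y \<in> S" for y
    using that S by (auto simp: closure_of_subtopology beta_dense inf.absorb2)
  {
    assume szd: "strongly_zero_dimensional ?Y"
    have "separated_between X {x \<in> topspace X. f x = 0} {x \<in> topspace X. f x = 1}"
      if f: "continuous_map X (top_of_set {0..1::real}) f" for f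
    proof -
      have f': "continuous_map X euclideanreal f" "f ` topspace X \<subseteq> {0..1}"
        using f by (auto simp: continuous_map_in_subtopology)
      have "bounded (f ` topspace X)"
        by (rule bounded_subset[OF bounded_closed_interval f'(2)])
      then obtain F where F: "continuous_map (beta X) euclidean F"
        "\<And>x. x \<in> topspace X \<Longrightarrow> F (beta_embed X x) = f x"
        using ex_extension_real[OF f'(1)] by blast
      obtain U where U: "openin ?Y U" "closedin ?Y U"
        "\<And>y. y \<in> topspace ?Y \<Longrightarrow> F y \<le> 0 \<Longrightarrow> y \<notin> U"
        "\<And>y. y \<in> topspace ?Y \<Longrightarrow> 1 \<le> F y \<Longrightarrow> y \<in> U"
        using separated_levels[OF szd continuous_map_from_subtopology[OF F(1)], of 0 1] by auto
      let ?U = "{x \<in> topspace X. beta_embed X x \<in> U}"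
      have "openin X ?U" "closedin X ?U"
        using openin_continuous_map_preimage[OF cb U(1)] closedin_continuous_map_preimage[OF cb U(2)]
        by auto
      moreover have "{x \<in> topspace X. f x = 1} \<subseteq> ?U" "{x \<in> topspace X. f x = 0} \<subseteq> topspace X - ?U"
        using U(3,4) F(2) S(2) unfolding tY by (auto simp: image_subset_iff)
      ultimately have "separated_between X {x \<in> topspace X. f x = 1} {x \<in> topspace X. f x = 0}"
        unfolding separated_between by blast
      then show ?thesis by (simp add: separated_between_sym)
    qed
    then show "strongly_zero_dimensional X"
      using X by (simp add: strongly_zero_dimensional_iff_separated_between)
  }
  assume szd: "strongly_zero_dimensional X"
  have "separated_between ?Y {y \<in> topspace ?Y. f y = 0} {y \<in> topspace ?Y. f y = 1}"
    if f: "continuous_map ?Y (top_of_set {0..1::real}) f" for f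
  proof -
    have f': "continuous_map ?Y euclideanreal f"
      using f by (auto simp: continuous_map_in_subtopology)
    have fe: "continuous_map X euclideanreal (\<lambda>x. f (beta_embed X x))"
      using continuous_map_compose[OF cb f'] by (simp add: o_def)
    \<comment> \<open>Points of \<open>Y\<close> with value \<open>0\<close> or \<open>1\<close> need not lie in \<open>X\<close>. The levels are therefore relaxed to
      \<open>1/3\<close> and \<open>2/3\<close>, which every point of \<open>X\<close> close enough to such a point meets.\<close>
    obtain U where U: "openin X U" "closedin X U"
      "\<And>x. x \<in> topspace X \<Longrightarrow> f (beta_embed X x) \<le> 1/3 \<Longrightarrow> x \<notin> U"
      "\<And>x. x \<in> topspace X \<Longrightarrow> 2/3 \<le> f (beta_embed X x) \<Longrightarrow> x \<in> U"
      using separated_levels[OF szd fe, of "1/3" "2/3"] by auto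
    let ?u = "\<lambda>x. if x \<in> U then 1 else 0 :: real"
    have "bounded (?u ` topspace X)" by (auto simp: bounded_iff intro!: exI[of _ 1])
    then obtain F where F: "continuous_map (beta X) euclideanreal F"
      "\<And>x. x \<in> topspace X \<Longrightarrow> F (beta_embed X x) = ?u x"
      using ex_extension_real[OF continuous_map_indicator[OF U(1,2), of 1 0]] by blast
    have FY: "continuous_map ?Y euclideanreal F"
      using F(1) by (rule continuous_map_from_subtopology)
    have zero: "h y = 0" if "y \<in> S" "continuous_map ?Y euclideanreal h"
      "\<And>x. x \<in> topspace X \<Longrightarrow> h (beta_embed X x) = 0" for h y
      by (rule forall_in_closure_of_eq[OF dense[OF that(1)], of euclideanreal h "\<lambda>_. 0"]) (use that in auto)
    have F01: "F y = 0 \<or> F y = 1" if "y \<in> S" for y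
    proof -
      have "F y * (F y - 1) = 0"
      proof (rule zero[OF that])
        show "continuous_map ?Y euclideanreal (\<lambda>y. F y * (F y - 1))"
          by (intro continuous_intros FY) simp_all
        show "F (beta_embed X x) * (F (beta_embed X x) - 1) = 0" if "x \<in> topspace X" for x
          using F(2)[OF that] by auto
      qed
      then show ?thesis by simp
    qed
    have F0: "F y = 0" if "y \<in> S" "f y = 0" for y
    proof -
      \<comment> \<open>The first factor is positive at \<open>y\<close> and vanishes wherever \<open>f \<ge> 1/3\<close>, so that density turns
        the separation on \<open>X\<close> into a statement about \<open>y\<close>.\<close>
      have "max (1/3 - f y) 0 * F y = 0"
      proof (rule zero[OF that(1)])
        show "continuous_map ?Y euclideanreal (\<lambda>y. max (1/3 - f y) 0 * F y)"
          by (intro continuous_intros FY f') simp_all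
        show "max (1/3 - f (beta_embed X x)) 0 * F (beta_embed X x) = 0" if "x \<in> topspace X" for x
          using F(2)[OF that] U(3)[OF that] by (auto simp: max_def)
      qed
      then show ?thesis using that by simp
    qed
    have F1: "F y = 1" if "y \<in> S" "f y = 1" for y
    proof -
      have "max (f y - 2/3) 0 * (F y - 1) = 0"
      proof (rule zero[OF that(1)])
        show "continuous_map ?Y euclideanreal (\<lambda>y. max (f y - 2/3) 0 * (F y - 1))"
          by (intro continuous_intros FY f') simp_all
        show "max (f (beta_embed X x) - 2/3) 0 * (F (beta_embed X x) - 1) = 0" if "x \<in> topspace X" for x
          using F(2)[OF that] U(4)[OF that] by (auto simp: max_def)
      qed
      then show ?thesis using that by simp
    qed
    let ?E = "{y \<in> topspace ?Y. F y \<in> {0}}"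
    have "closedin ?Y ?E"
      by (rule closedin_continuous_map_preimage[OF FY]) simp
    moreover have "?E = {y \<in> topspace ?Y. F y \<in> - {1}}"
      using F01 unfolding tY by force
    then have "openin ?Y ?E"
      using openin_continuous_map_preimage[OF FY, of "- {1}"] by (simp add: open_Compl)
    moreover have "{y \<in> topspace ?Y. f y = 0} \<subseteq> ?E" "{y \<in> topspace ?Y. f y = 1} \<subseteq> topspace ?Y - ?E"
      using F0 F1 unfolding tY by auto
    ultimately show ?thesis unfolding separated_between by blast
  qed
  moreover have "completely_regular_space (beta X)"
    using compact_beta[of X] Hausdorff_beta[of X]
    by (simp add: normal_imp_completely_regular_space compact_Hausdorff_or_regular_imp_normal_space)
  ultimately show "strongly_zero_dimensional ?Y"
    unfolding strongly_zero_dimensional_iff_separated_between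
    by (auto intro: completely_regular_space_subtopology Hausdorff_space_subtopology[OF Hausdorff_beta])
qed

section \<open>Consequences of strong zero-dimensionality for closed ideals\<close>

text \<open>
  The tool for both consequences. A clopen set \<open>U\<close> between \<open>{|g| \<ge> e}\<close> and \<open>{|g| > e/2}\<close> makes \<open>g\<close>
  invertible on \<open>U\<close>, so the indicator of \<open>U\<close> is a multiple of \<open>g\<close>; off \<open>U\<close> the values of \<open>g\<close> are small,
  so that \<open>g\<close> is close to its restriction to \<open>U\<close>.
\<close>

lemma clopen_truncation:
  fixes g :: "'a \<Rightarrow> 'f::real_normed_field"
  assumes szd: "strongly_zero_dimensional X" and g: "g \<in> carrier (CB X)" and e: "0 < e"
  obtains U h where "openin X U" "closedin X U" "h \<in> carrier (CB X)"
    "h \<otimes>\<^bsub>CB X\<^esub> g = clopen_indicator X U"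
    "mdist (CB_metric X) g (g \<otimes>\<^bsub>CB X\<^esub> clopen_indicator X U) \<le> e"
proof -
  note gc = CB_continuous[OF g]
  obtain U where U: "openin X U" "closedin X U"
    "\<And>x. x \<in> topspace X \<Longrightarrow> norm (g x) \<le> e/2 \<Longrightarrow> x \<notin> U" "\<And>x. x \<in> topspace X \<Longrightarrow> e \<le> norm (g x) \<Longrightarrow> x \<in> U"
    using separated_levels[OF szd continuous_map_norm[OF gc], of "e/2" e] e by auto
  \<comment> \<open>The value \<open>1\<close> off \<open>U\<close> keeps \<open>k\<close> bounded away from \<open>0\<close> on the whole space, so \<open>1/k\<close> is bounded.\<close>
  define k where "k x = (if x \<in> U then g x else 1)" for x
  have k: "continuous_map X euclidean k"
  proof -
    have "continuous_map X euclidean (\<lambda>x. g x * (if x \<in> U then 1 else 0) + (if x \<in> U then 0 else 1))"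
      by (intro continuous_map_field_ops gc continuous_map_indicator[OF U(1,2)])
    moreover have "(\<lambda>x. g x * (if x \<in> U then 1 else 0) + (if x \<in> U then 0 else 1)) = k"
      by (auto simp: k_def)
    ultimately show ?thesis by simp
  qed
  have klow: "min (e/2) 1 \<le> norm (k x)" if "x \<in> topspace X" for x
  proof -
    have "x \<in> U \<Longrightarrow> e/2 < norm (g x)" using U(3)[OF that] by (meson not_le)
    then show ?thesis by (auto simp: k_def)
  qed
  have k0: "k x \<noteq> 0" if "x \<in> topspace X" for x
    using klow[OF that] e by auto
  define h where "h = (\<lambda>x\<in>topspace X. inverse (k x) * (if x \<in> U then 1 else 0))"
  have "h \<in> carrier (CB X)" unfolding h_def
  proof (rule CB_restrictI)
    show "continuous_map X euclidean (\<lambda>x. inverse (k x) * (if x \<in> U then 1 else 0))"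
      by (intro continuous_map_field_ops continuous_map_field_inverse k k0 continuous_map_indicator[OF U(1,2)])
    show "norm (inverse (k x) * (if x \<in> U then 1 else 0)) \<le> inverse (min (e/2) 1)" if "x \<in> topspace X" for x
      using klow[OF that] e le_imp_inverse_le[OF klow[OF that]] by (auto simp: norm_inverse)
  qed
  moreover have "h \<otimes>\<^bsub>CB X\<^esub> g = clopen_indicator X U"
  proof -
    have "inverse (k x) * g x = 1" if "x \<in> topspace X" "x \<in> U" for x
      using k0[OF that(1)] that(2) by (simp add: k_def)
    then show ?thesis by (auto simp: CB_simps clopen_indicator_def h_def fun_eq_iff)
  qed
  moreover have "mdist (CB_metric X) g (g \<otimes>\<^bsub>CB X\<^esub> clopen_indicator X U) \<le> e"
    using e by (intro mdist_CB_le) (auto simp: CB_simps clopen_indicator_def dest: U(4) intro: leI less_imp_le)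
  ultimately show thesis using that U by blast
qed

lemma nat_pow_2_idem: "g \<in> carrier (CB X) \<Longrightarrow> g [^]\<^bsub>CB X\<^esub> (2::nat) = g \<longleftrightarrow> g \<otimes>\<^bsub>CB X\<^esub> g = (g :: 'a \<Rightarrow> 'f::real_normed_field)"
proof -
  assume g: "g \<in> carrier (CB X)"
  interpret R: cring "CB X :: ('a \<Rightarrow> 'f) ring" by (rule cring_CB)
  show ?thesis using g by (simp add: numeral_2_eq_2)
qed

lemma closed_ideal_closure: "closed_ideal X G \<Longrightarrow> CB_closure X G = G"
  by (simp add: closed_ideal_def closure_of_closedin)

text \<open>
  For \<open>g \<in> G\<close> the indicator of \<open>clopen_truncation\<close> is a multiple of \<open>g\<close>, hence an idempotent of \<open>G\<close>,
  and the truncation of \<open>g\<close> is a multiple of this idempotent that approximates \<open>g\<close>.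
\<close>

lemma closed_ideal_generated_by_idempotents:
  fixes G :: "('a \<Rightarrow> 'f::real_normed_field) set"
  assumes szd: "strongly_zero_dimensional X" and G: "closed_ideal X G"
  shows "G = CB_closure X (Idl\<^bsub>CB X\<^esub> {g \<in> G. g [^]\<^bsub>CB X\<^esub> (2::nat) = g})" (is "G = CB_closure X ?I")
proof
  interpret R: cring "CB X :: ('a \<Rightarrow> 'f) ring" by (rule cring_CB)
  interpret G: ideal G "CB X" using G by (simp add: closed_ideal_def)
  have gen: "{g \<in> G. g [^]\<^bsub>CB X\<^esub> (2::nat) = g} \<subseteq> carrier (CB X)" using G.a_subset by blast
  interpret I: ideal ?I "CB X" by (rule R.genideal_ideal[OF gen])
  have "?I \<subseteq> G" by (rule R.genideal_minimal[OF G.is_ideal]) blast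
  then show "CB_closure X ?I \<subseteq> G"
    using closure_of_mono[of ?I G] closed_ideal_closure[OF G] by blast
  show "G \<subseteq> CB_closure X ?I"
    unfolding in_CB_closure_iff subset_iff
  proof (intro allI impI conjI)
    fix g and e :: real assume g: "g \<in> G" and e: "0 < e"
    have gR: "g \<in> carrier (CB X)" using g by (rule G.Icarr)
    obtain U h where U: "openin X U" "closedin X U" "h \<in> carrier (CB X)"
      "h \<otimes>\<^bsub>CB X\<^esub> g = clopen_indicator X U"
      "mdist (CB_metric X) g (g \<otimes>\<^bsub>CB X\<^esub> clopen_indicator X U) \<le> e/2"
      using clopen_truncation[OF szd gR, of "e/2"] e by auto
    let ?u = "clopen_indicator X U :: 'a \<Rightarrow> 'f"
    have "?u \<in> G" using G.I_l_closed[OF g U(3)] U(4) by simp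
    then have "?u \<in> ?I"
      using R.genideal_self[OF gen] clopen_indicator_idem[of X U] G.Icarr nat_pow_2_idem[of ?u X] by blast
    then have "g \<otimes>\<^bsub>CB X\<^esub> ?u \<in> ?I" using gR by (rule I.I_l_closed)
    moreover have "mdist (CB_metric X) g (g \<otimes>\<^bsub>CB X\<^esub> ?u) < e" using U(5) e by simp
    ultimately show "\<exists>k\<in>?I. k \<in> carrier (CB X) \<and> mdist (CB_metric X) g k < e"
      using I.Icarr by blast
  next
    fix g assume "g \<in> G"
    then show "g \<in> carrier (CB X)" by (rule G.Icarr)
  qed
qed

text \<open>
  If some clopen set gives two idempotents neither of which is in \<open>G\<close>, they decompose the whole
  quotient. Otherwise \<open>G\<close> contains one of the two idempotents for every clopen set. For \<open>f \<notin> G\<close>, some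
  truncation of \<open>f\<close> is not in \<open>G\<close>, because \<open>G\<close> is closed; then the indicator of its clopen set is not
  in \<open>G\<close>, so it is \<open>1\<close> modulo \<open>G\<close>, and it is a multiple of \<open>f\<close>. So the quotient is zero or a field.
\<close>

lemma quotient_alternative:
  fixes G :: "('a \<Rightarrow> 'f::real_normed_field) set"
  assumes szd: "strongly_zero_dimensional X" and G: "closed_ideal X G"
  shows "carrier (CB X Quot G) = {\<zero>\<^bsub>CB X Quot G\<^esub>} \<or>
         simple_ideal (CB X Quot G) (carrier (CB X Quot G)) \<or>
         (\<exists>D. decomposable_ideal (CB X Quot G) D \<and>
              carrier (CB X Quot G) = quot_closure X G D)"
proof -
  let ?R = "CB X :: ('a \<Rightarrow> 'f) ring" and ?Q = "CB X Quot G"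
  let ?\<pi> = "\<lambda>f. G +>\<^bsub>?R\<^esub> f"
  interpret R: cring ?R by (rule cring_CB)
  interpret G: ideal G ?R using G by (simp add: closed_ideal_def)
  interpret H: ring_hom_cring ?R ?Q ?\<pi> by (rule G.rcos_ring_hom_cring[OF R.is_cring])
  note zero_iff = G.coset_eq_zero_iff
  show ?thesis
  proof (cases "\<exists>U. openin X U \<and> closedin X U \<and> clopen_indicator X U \<notin> G \<and>
                  clopen_indicator X (topspace X - U) \<notin> G")
    case True
    then obtain U where U: "openin X U" "closedin X U"
      and nG: "(clopen_indicator X U :: 'a \<Rightarrow> 'f) \<notin> G" "(clopen_indicator X (topspace X - U) :: 'a \<Rightarrow> 'f) \<notin> G"
      by blast
    let ?e = "clopen_indicator X U :: 'a \<Rightarrow> 'f" and ?f = "clopen_indicator X (topspace X - U) :: 'a \<Rightarrow> 'f"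
    have e: "?e \<in> carrier ?R" "?f \<in> carrier ?R"
      using U by (auto intro: clopen_indicator_CB)
    have "?\<pi> ?e \<oplus>\<^bsub>?Q\<^esub> ?\<pi> ?f = \<one>\<^bsub>?Q\<^esub>"
      using H.hom_add[OF e] clopen_indicator_compl[of X U, where 'b='f] by simp
    moreover have "?\<pi> ?e \<otimes>\<^bsub>?Q\<^esub> ?\<pi> ?f = \<zero>\<^bsub>?Q\<^esub>"
      using H.hom_mult[OF e] clopen_indicator_orth[of X U, where 'b='f] by simp
    moreover have "?\<pi> ?e \<noteq> \<zero>\<^bsub>?Q\<^esub>" "?\<pi> ?f \<noteq> \<zero>\<^bsub>?Q\<^esub>"
      using zero_iff[OF e(1)] zero_iff[OF e(2)] nG by auto
    ultimately have "decomposable_ideal ?Q (carrier ?Q)"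
      using H.S.carrier_decomposable H.hom_closed e by blast
    moreover have "quot_closure X G (carrier ?Q) = carrier ?Q"
      using closure_of_topspace[of "Metric_space.mtopology (carrier ?Q) (quot_dist X G)"]
      by (simp add: Metric_space.topspace_mtopology[OF quotient_metric[OF G]])
    ultimately show ?thesis by metis
  next
    case False
    have "\<exists>y\<in>carrier ?Q. y \<otimes>\<^bsub>?Q\<^esub> K = \<one>\<^bsub>?Q\<^esub>" if K: "K \<in> carrier ?Q" "K \<noteq> \<zero>\<^bsub>?Q\<^esub>" for K
    proof -
      obtain f where f: "f \<in> carrier ?R" "K = ?\<pi> f" using G.ex_coset_rep[OF K(1)] by blast
      then have "f \<notin> G" using K zero_iff by blast
      then obtain e where e: "e > 0" "\<And>g. g \<in> G \<Longrightarrow> \<not> mdist (CB_metric X) f g < e"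
        using closed_ideal_closure[OF G] in_CB_closure_iff[of f X G] f(1) G.Icarr by blast
      obtain U h where U: "openin X U" "closedin X U" and h: "h \<in> carrier ?R"
        "h \<otimes>\<^bsub>?R\<^esub> f = clopen_indicator X U"
        and d: "mdist (CB_metric X) f (f \<otimes>\<^bsub>?R\<^esub> clopen_indicator X U) \<le> e/2"
        using clopen_truncation[OF szd f(1), of "e/2"] e by auto
      let ?u = "clopen_indicator X U :: 'a \<Rightarrow> 'f" and ?v = "clopen_indicator X (topspace X - U) :: 'a \<Rightarrow> 'f"
      have uv: "?u \<in> carrier ?R" "?v \<in> carrier ?R"
        using U by (auto intro: clopen_indicator_CB)
      have "?u \<notin> G"
      proof
        assume "?u \<in> G"
        then have "f \<otimes>\<^bsub>?R\<^esub> ?u \<in> G" using f(1) by (rule G.I_l_closed)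
        then show False using e d by force
      qed
      then have "?v \<in> G" using False U by blast
      then have "?\<pi> ?u = \<one>\<^bsub>?Q\<^esub>"
        using H.hom_add[OF uv] clopen_indicator_compl[of X U, where 'b='f] zero_iff[OF uv(2)] uv by simp
      then have "?\<pi> h \<otimes>\<^bsub>?Q\<^esub> K = \<one>\<^bsub>?Q\<^esub>"
        using H.hom_mult[OF h(1) f(1)] h(2) f(2) by simp
      then show ?thesis using H.hom_closed[OF h(1)] by blast
    qed
    then show ?thesis using H.S.simple_if_nonzero_invertible by blast
  qed
qed


section \<open>Closed ideals of functions vanishing on a subset of the compactification\<close>

text \<open>
  The argument uses the scalar field only through the existence of extensions to \<open>\<beta>X\<close>; the locale
  treats the real and the complex case together. The parameter \<open>scalars\<close> only carries the type.
\<close>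

locale beta_extendable =
  fixes X :: "'a topology" and scalars :: "'f::real_normed_field itself"
  assumes extension: "\<And>f. f \<in> carrier (CB X :: ('a \<Rightarrow> 'f) ring) \<Longrightarrow> is_beta_extension X f (beta_extension X f)"
begin

abbreviation "R \<equiv> CB X :: ('a \<Rightarrow> 'f) ring"

sublocale R: cring R by (rule cring_CB)

lemma beta_extension_eqI:
  assumes "continuous_map (beta X) euclidean F" "\<And>x. x \<in> topspace X \<Longrightarrow> F (beta_embed X x) = f x"
    "f \<in> carrier R" "p \<in> topspace (beta X)"
  shows "beta_extension X f p = F p"
  using beta_extension_unique[OF extension[OF assms(3)] is_beta_extension_restrict[OF assms(1,2)]]
    assms(4) by simp

lemma continuous_beta_extension: "f \<in> carrier R \<Longrightarrow> continuous_map (beta X) euclidean (beta_extension X f)"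
  using extension by (simp add: is_beta_extension_def)

lemma beta_extension_embed:
  "f \<in> carrier R \<Longrightarrow> x \<in> topspace X \<Longrightarrow> beta_extension X f (beta_embed X x) = f x"
  using extension by (simp add: is_beta_extension_def)

text \<open>
  In each case both sides are values of continuous functions on \<open>\<beta>X\<close> that agree on the dense subset \<open>X\<close>.
\<close>

lemma beta_extension_hom:
  assumes p: "p \<in> topspace (beta X)"
  shows beta_extension_add: "f \<in> carrier R \<Longrightarrow> g \<in> carrier R \<Longrightarrow>
      beta_extension X (f \<oplus>\<^bsub>R\<^esub> g) p = beta_extension X f p + beta_extension X g p"
    and beta_extension_mult: "f \<in> carrier R \<Longrightarrow> g \<in> carrier R \<Longrightarrow>
      beta_extension X (f \<otimes>\<^bsub>R\<^esub> g) p = beta_extension X f p * beta_extension X g p"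
    and beta_extension_zero: "beta_extension X \<zero>\<^bsub>R\<^esub> p = 0"
    and beta_extension_one: "beta_extension X \<one>\<^bsub>R\<^esub> p = 1"
proof -
  show "beta_extension X (f \<oplus>\<^bsub>R\<^esub> g) p = beta_extension X f p + beta_extension X g p"
    "beta_extension X (f \<otimes>\<^bsub>R\<^esub> g) p = beta_extension X f p * beta_extension X g p"
    if fg: "f \<in> carrier R" "g \<in> carrier R"
    using fg p continuous_map_field_ops(1,2)[OF fg[THEN continuous_beta_extension]]
    by (auto intro!: beta_extension_eqI simp: beta_extension_embed) (simp_all add: CB_simps)
  show "beta_extension X \<zero>\<^bsub>R\<^esub> p = 0" "beta_extension X \<one>\<^bsub>R\<^esub> p = 1"
    using p beta_extension_eqI[OF _ _ R.zero_closed p, of "\<lambda>_. 0"]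
      beta_extension_eqI[OF _ _ R.one_closed p, of "\<lambda>_. 1"] by (simp_all add: CB_simps)
qed

lemma beta_extension_bound:
  assumes f: "f \<in> carrier R" and p: "p \<in> topspace (beta X)" and b: "\<And>x. x \<in> topspace X \<Longrightarrow> norm (f x) \<le> e"
  shows "norm (beta_extension X f p) \<le> e"
proof -
  have "p \<in> beta X closure_of (beta_embed X ` topspace X)"
    using p by (simp add: beta_dense)
  then show ?thesis
  proof (rule forall_in_closure_of)
    show "norm (beta_extension X f y) \<le> e" if "y \<in> beta_embed X ` topspace X" for y
      using that b beta_extension_embed[OF f] by auto
    have "closedin (beta X) {y \<in> topspace (beta X). norm (beta_extension X f y) \<in> {..e}}"
      by (rule closedin_continuous_map_preimage[OF continuous_map_norm[OF continuous_beta_extension[OF f]]]) simp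
    then show "closedin (beta X) {y \<in> topspace (beta X). norm (beta_extension X f y) \<le> e}" by simp
  qed
qed

definition vanishing_ideal :: "(('a \<Rightarrow> real) \<Rightarrow> real) set \<Rightarrow> ('a \<Rightarrow> 'f) set"
  where "vanishing_ideal C = {f \<in> carrier R. \<forall>p\<in>C. beta_extension X f p = 0}"

lemma vanishing_idealD: "f \<in> vanishing_ideal C \<Longrightarrow> p \<in> C \<Longrightarrow> beta_extension X f p = 0"
  by (simp add: vanishing_ideal_def)

lemma vanishing_idealI:
  "f \<in> carrier R \<Longrightarrow> (\<And>p. p \<in> C \<Longrightarrow> beta_extension X f p = 0) \<Longrightarrow> f \<in> vanishing_ideal C"
  by (simp add: vanishing_ideal_def)

text \<open>
  Closedness holds because evaluation at a point of \<open>\<beta>X\<close> is norm-decreasing.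
\<close>

lemma closed_ideal_vanishing:
  assumes C: "C \<subseteq> topspace (beta X)"
  shows "closed_ideal X (vanishing_ideal C)"
  unfolding closed_ideal_def
proof
  let ?V = "vanishing_ideal C"
  have VR: "?V \<subseteq> carrier R" by (auto simp: vanishing_ideal_def)
  show ideal: "ideal ?V (CB X)"
    using C by (intro R.idealI_cring)
      (auto simp: vanishing_ideal_def beta_extension_zero beta_extension_add beta_extension_mult subset_iff)
  interpret V: ideal ?V R by (rule ideal)
  have "CB_closure X ?V \<subseteq> ?V"
  proof
    fix f assume f: "f \<in> CB_closure X ?V"
    then have fR: "f \<in> carrier R" by (simp add: in_CB_closure_iff)
    have "beta_extension X f p = 0" if p: "p \<in> C" for p
    proof -
      have pb: "p \<in> topspace (beta X)" using p C by blast
      have "norm (beta_extension X f p) \<le> e" if "e > 0" for e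
      proof -
        obtain g where g: "g \<in> ?V" "g \<in> carrier R" "mdist (CB_metric X) f g < e"
          using f \<open>e > 0\<close> unfolding in_CB_closure_iff by blast
        have d: "f \<ominus>\<^bsub>R\<^esub> g \<in> carrier R" using fR g by simp
        have "beta_extension X f p = beta_extension X ((f \<ominus>\<^bsub>R\<^esub> g) \<oplus>\<^bsub>R\<^esub> g) p"
          using fR g by (simp add: R.minus_eq R.a_assoc R.l_neg)
        also have "\<dots> = beta_extension X (f \<ominus>\<^bsub>R\<^esub> g) p"
          using beta_extension_add[OF pb d g(2)] vanishing_idealD[OF g(1) p] by (metis add_0_right)
        finally have eq: "beta_extension X f p = beta_extension X (f \<ominus>\<^bsub>R\<^esub> g) p" .
        show ?thesis unfolding eq
        proof (rule beta_extension_bound[OF d pb])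
          show "norm ((f \<ominus>\<^bsub>R\<^esub> g) x) \<le> e" if "x \<in> topspace X" for x
            using norm_diff_le_mdist[OF fR g(2) that] g(3) that by (simp add: CB_minus[OF fR g(2)])
        qed
      qed
      then have "norm (beta_extension X f p) \<le> 0" by (rule field_le_epsilon) simp
      then show ?thesis by simp
    qed
    with fR show "f \<in> ?V" by (rule vanishing_idealI)
  qed
  moreover have "?V \<subseteq> CB_closure X ?V"
    using VR by (intro closure_of_subset) (simp add: mspace_CB_metric)
  ultimately show "closedin (mtopology_of (CB_metric X)) ?V"
    by (metis closedin_closure_of subset_antisym)
qed


section \<open>Recovering strong zero-dimensionality from the ideal structure\<close>

lemma real_valued_in_CB:
  assumes "continuous_map X (top_of_set {0..1::real}) f"
  shows "(\<lambda>x\<in>topspace X. of_real (f x)) \<in> carrier R"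
proof (rule CB_restrictI)
  have "continuous_map X euclideanreal f"
    using assms by (simp add: continuous_map_in_subtopology)
  then show "continuous_map X euclidean (\<lambda>x. of_real (f x) :: 'f)"
    by (simp add: continuous_map_atin tendsto_of_real)
  show "norm (of_real (f x) :: 'f) \<le> 1" if "x \<in> topspace X" for x
    using assms that by (auto simp: continuous_map_in_subtopology image_subset_iff Pi_iff)
qed

text \<open>
  Let \<open>A = {f = 0}\<close> and let \<open>G\<close> be the closed ideal of functions that vanish on \<open>A\<close>. An element \<open>h\<close> of the
  ideal generated by the idempotents of \<open>G\<close> is supported in a finite union of their supports, which
  is a clopen set disjoint from \<open>A\<close>. Since \<open>f \<in> G\<close>, there is such an \<open>h\<close> at distance less than \<open>1\<close>
  from \<open>f\<close>, and its clopen set contains all points with \<open>f = 1\<close>.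
\<close>

lemma strongly_zero_dimensional_if_idempotents_generate:
  assumes X: "completely_regular_space X" "Hausdorff_space X"
    and gen: "\<And>G :: ('a \<Rightarrow> 'f) set. closed_ideal X G \<Longrightarrow>
      G = CB_closure X (Idl\<^bsub>CB X\<^esub> {g \<in> G. g [^]\<^bsub>CB X\<^esub> (2::nat) = g})"
  shows "strongly_zero_dimensional X"
proof -
  have "separated_between X {x \<in> topspace X. f x = 1} {x \<in> topspace X. f x = 0}"
    if f: "continuous_map X (top_of_set {0..1::real}) f" for f
  proof -
    let ?A = "{x \<in> topspace X. f x = 0}"
    define F :: "'a \<Rightarrow> 'f" where "F = (\<lambda>x\<in>topspace X. of_real (f x))"
    have F: "F \<in> carrier R" unfolding F_def by (rule real_valued_in_CB[OF f])
    define G where "G = vanishing_ideal (beta_embed X ` ?A)"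
    have G: "closed_ideal X G"
      unfolding G_def using beta_embed_image[of X] by (intro closed_ideal_vanishing) auto
    have Gv: "g x = 0" if "g \<in> G" "x \<in> ?A" for g x
      using that beta_extension_embed[of g x] by (auto simp: G_def vanishing_ideal_def)
    have "F \<in> G"
      using F beta_extension_embed[OF F] by (auto simp: G_def vanishing_ideal_def F_def)
    let ?E = "{g \<in> G. g [^]\<^bsub>R\<^esub> (2::nat) = g}"
    \<comment> \<open>Functions carried by a clopen set off \<open>A\<close>: an ideal that contains the idempotents of \<open>G\<close>, so
      that finite sums of multiples of idempotents need not be handled explicitly.\<close>
    define J where "J = {h \<in> carrier R. \<exists>U. openin X U \<and> closedin X U \<and> U \<inter> ?A = {} \<and>
                        (\<forall>x\<in>topspace X - U. h x = 0)}"
    have "ideal J R"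
    proof (rule R.idealI_cring)
      show "\<zero>\<^bsub>R\<^esub> \<in> J"
        unfolding J_def using R.zero_closed by (auto simp: CB_simps intro!: exI[of _ "{}"])
      show "a \<oplus>\<^bsub>R\<^esub> b \<in> J" if ab: "a \<in> J" "b \<in> J" for a b
      proof -
        obtain U V where "openin X U" "closedin X U" "U \<inter> ?A = {}" "\<forall>x\<in>topspace X - U. a x = 0"
          "openin X V" "closedin X V" "V \<inter> ?A = {}" "\<forall>x\<in>topspace X - V. b x = 0"
          using ab unfolding J_def by auto
        then have "openin X (U \<union> V) \<and> closedin X (U \<union> V) \<and> (U \<union> V) \<inter> ?A = {} \<and>
            (\<forall>x\<in>topspace X - (U \<union> V). (a \<oplus>\<^bsub>R\<^esub> b) x = 0)"
          by (simp add: CB_simps Int_Un_distrib2 openin_Un closedin_Un)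
        then show ?thesis using ab unfolding J_def by blast
      qed
      show "r \<otimes>\<^bsub>R\<^esub> a \<in> J" if "a \<in> J" "r \<in> carrier R" for a r
      proof -
        have aR: "a \<in> carrier R" using that(1) by (simp add: J_def)
        have "\<exists>U. openin X U \<and> closedin X U \<and> U \<inter> ?A = {} \<and> (\<forall>x\<in>topspace X - U. a x = 0)"
          using that(1) by (simp add: J_def)
        then have "\<exists>U. openin X U \<and> closedin X U \<and> U \<inter> ?A = {} \<and>
            (\<forall>x\<in>topspace X - U. (r \<otimes>\<^bsub>R\<^esub> a) x = 0)"
          by (elim ex_forward) (simp add: CB_simps)
        then show ?thesis using R.m_closed[OF that(2) aR] by (simp add: J_def)
      qed
    qed (auto simp: J_def)
    moreover have "?E \<subseteq> J"
    proof
      fix g assume g: "g \<in> ?E"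
      then have gR: "g \<in> carrier R" by (simp add: G_def vanishing_ideal_def)
      then have idem: "g \<otimes>\<^bsub>R\<^esub> g = g" using g nat_pow_2_idem[OF gR] by simp
      have "{x \<in> topspace X. g x \<noteq> 0} \<inter> ?A = {}" using g Gv by blast
      then show "g \<in> J" unfolding J_def using gR idempotent_support_clopen[OF gR idem]
        by (intro CollectI conjI exI[of _ "{x \<in> topspace X. g x \<noteq> 0}"]) auto
    qed
    ultimately have "Idl\<^bsub>R\<^esub> ?E \<subseteq> J" by (rule R.genideal_minimal)
    moreover have "F \<in> CB_closure X (Idl\<^bsub>R\<^esub> ?E)" using gen[OF G] \<open>F \<in> G\<close> by blast
    ultimately obtain h where h: "h \<in> J" "h \<in> carrier R" "mdist (CB_metric X) F h < 1"
      unfolding in_CB_closure_iff using zero_less_one by blast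
    then obtain U where U: "openin X U" "closedin X U" "U \<inter> ?A = {}" "\<forall>x\<in>topspace X - U. h x = 0"
      unfolding J_def by blast
    have "x \<in> U" if "x \<in> topspace X" "f x = 1" for x
    proof (rule ccontr)
      assume "x \<notin> U"
      then have "norm (F x - h x) = 1" using U(4) that by (simp add: F_def)
      then show False using norm_diff_le_mdist[OF F h(2) that(1)] h(3) by simp
    qed
    then show ?thesis unfolding separated_between using U by (intro exI[of _ U]) blast
  qed
  then show ?thesis
    using X unfolding strongly_zero_dimensional_iff_separated_between
    by (auto intro: separated_between_sym[THEN iffD1])
qed

text \<open>
  The quotient embeds into the continuous functions on \<open>C\<close>. If \<open>a + b\<close> with \<open>a \<in> I\<close>, \<open>b \<in> J\<close> is at distance less than
  \<open>1\<close> from the unit, it has no zero on \<open>C\<close>, so the cozero-sets of \<open>a\<close> and \<open>b\<close> cover \<open>C\<close>. They are disjoint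
  because \<open>I \<inter> J = 0\<close>. If the cozero-set of \<open>a\<close> were empty, \<open>b\<close> would have no zero on \<open>C\<close>, and all of
  \<open>I\<close> would vanish because its products with \<open>b\<close> do; likewise for \<open>b\<close>. So \<open>C\<close> would be disconnected.
\<close>

lemma connected_quotient_not_decomposable:
  assumes C: "connectedin (beta X) C" and D: "decomposable_ideal (R Quot vanishing_ideal C) D"
  shows "\<one>\<^bsub>R Quot vanishing_ideal C\<^esub> \<notin> quot_closure X (vanishing_ideal C) D"
proof
  let ?G = "vanishing_ideal C"
  let ?Q = "R Quot ?G" and ?\<pi> = "\<lambda>f. ?G +>\<^bsub>R\<^esub> f"
  have Cb: "C \<subseteq> topspace (beta X)" using C by (rule connectedin_subset_topspace)
  have clG: "closed_ideal X ?G" using Cb by (rule closed_ideal_vanishing)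
  interpret G: ideal ?G R using clG by (simp add: closed_ideal_def)
  interpret H: ring_hom_cring R ?Q ?\<pi> by (rule G.rcos_ring_hom_cring[OF R.is_cring])
  interpret M: Metric_space "carrier ?Q" "quot_dist X ?G" by (rule quotient_metric[OF clG])
  assume one: "\<one>\<^bsub>?Q\<^esub> \<in> quot_closure X ?G D"
  obtain I J where IJ: "ideal I ?Q" "ideal J ?Q" "I \<noteq> {\<zero>\<^bsub>?Q\<^esub>}" "J \<noteq> {\<zero>\<^bsub>?Q\<^esub>}"
    "I \<inter> J = {\<zero>\<^bsub>?Q\<^esub>}" "D = I <+>\<^bsub>?Q\<^esub> J"
    using D unfolding decomposable_ideal_def by blast
  obtain d where d: "d \<in> D" "quot_dist X ?G \<one>\<^bsub>?Q\<^esub> d < 1" "d \<in> carrier ?Q"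
    using one unfolding M.metric_closure_of M.in_mball using zero_less_one by blast
  obtain a b where ab: "a \<in> I" "b \<in> J" "d = a \<oplus>\<^bsub>?Q\<^esub> b"
    using d(1) IJ(6) unfolding set_add_def' by blast
  have carr: "a \<in> carrier ?Q" "b \<in> carrier ?Q"
    using ab ideal.Icarr[OF IJ(1)] ideal.Icarr[OF IJ(2)] by blast+
  obtain u v where u: "u \<in> carrier R" "a = ?\<pi> u" and v: "v \<in> carrier R" "b = ?\<pi> v"
    using G.ex_coset_rep carr by blast
  let ?w = "u \<oplus>\<^bsub>R\<^esub> v"
  let ?K = "\<one>\<^bsub>?Q\<^esub> \<ominus>\<^bsub>?Q\<^esub> d"
  have w: "?w \<in> carrier R" using u v by simp
  have dw: "d = ?\<pi> ?w" using ab u v by simp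
  have K: "?K = ?\<pi> (\<one>\<^bsub>R\<^esub> \<ominus>\<^bsub>R\<^esub> ?w)"
    unfolding dw using w by (simp add: a_minus_def)
  have self: "\<one>\<^bsub>R\<^esub> \<ominus>\<^bsub>R\<^esub> ?w \<in> ?K" unfolding K using w by (intro G.a_rcos_self) simp
  \<comment> \<open>The quotient norm is an infimum over representatives, so some representative \<open>k\<close> of \<open>1 - (a + b)\<close>
    has norm below \<open>1\<close>.\<close>
  have "quot_norm X ?K < 1" using d by (simp add: quot_dist_def)
  moreover have "bdd_below (CB_norm X ` ?K)" by (auto simp: bdd_below_def CB_norm_def intro!: exI[of _ 0])
  ultimately obtain k where k: "k \<in> ?K" "CB_norm X k < 1"
    unfolding quot_norm_def using cINF_less_iff[of ?K "CB_norm X" 1] self by blast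
  obtain h where h: "h \<in> ?G" "k = h \<oplus>\<^bsub>R\<^esub> (\<one>\<^bsub>R\<^esub> \<ominus>\<^bsub>R\<^esub> ?w)"
    using k(1) unfolding K a_r_coset_def' by blast
  have hR: "h \<in> carrier R" using h(1) by (rule G.Icarr)
  have kR: "k \<in> carrier R" using h(2) hR w by simp
  let ?\<beta> = "beta_extension X :: ('a \<Rightarrow> 'f) \<Rightarrow> _"
  have cover: "?\<beta> u p \<noteq> 0 \<or> ?\<beta> v p \<noteq> 0" if p: "p \<in> C" for p
  proof (rule ccontr)
    assume neg: "\<not> ?thesis"
    have pb: "p \<in> topspace (beta X)" using p Cb by blast
    have "k \<oplus>\<^bsub>R\<^esub> ?w = h \<oplus>\<^bsub>R\<^esub> \<one>\<^bsub>R\<^esub>"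
      unfolding h(2) using hR w by (simp add: a_minus_def R.a_assoc R.l_neg)
    then have "?\<beta> k p + ?\<beta> ?w p = ?\<beta> h p + ?\<beta> \<one>\<^bsub>R\<^esub> p"
      using beta_extension_add[OF pb kR w] beta_extension_add[OF pb hR R.one_closed] by simp
    moreover have "?\<beta> ?w p = 0" using neg beta_extension_add[OF pb u(1) v(1)] by simp
    moreover have "?\<beta> h p = 0" using h(1) p by (rule vanishing_idealD)
    ultimately have "?\<beta> k p = 1" using beta_extension_one[OF pb] by (metis add_0_left add_0_right)
    moreover have "norm (?\<beta> k p) \<le> CB_norm X k"
      using norm_le_CB_norm[OF kR] by (rule beta_extension_bound[OF kR pb])
    ultimately show False using k(2) by simp
  qed
  have orth: "?\<beta> f p * ?\<beta> g p = 0"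
    if "f \<in> carrier R" "?\<pi> f \<in> I" "g \<in> carrier R" "?\<pi> g \<in> J" "p \<in> C" for f g p
  proof -
    have "?\<pi> f \<otimes>\<^bsub>?Q\<^esub> ?\<pi> g \<in> I \<inter> J"
      using that ideal.I_r_closed[OF IJ(1)] ideal.I_l_closed[OF IJ(2)] H.hom_closed by blast
    then have "?\<pi> (f \<otimes>\<^bsub>R\<^esub> g) = \<zero>\<^bsub>?Q\<^esub>" using IJ(5) that by simp
    then have "f \<otimes>\<^bsub>R\<^esub> g \<in> ?G"
      using G.coset_eq_zero_iff[OF R.m_closed[OF that(1,3)]] by blast
    then have "?\<beta> (f \<otimes>\<^bsub>R\<^esub> g) p = 0" using that(5) by (rule vanishing_idealD)
    then show ?thesis using beta_extension_mult[OF _ that(1,3)] that(5) Cb by (metis subsetD)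
  qed
  have nonzero: "\<exists>f\<in>carrier R. ?\<pi> f \<in> L \<and> (\<exists>p\<in>C. ?\<beta> f p \<noteq> 0)"
    if L: "ideal L ?Q" "L \<noteq> {\<zero>\<^bsub>?Q\<^esub>}" for L
  proof -
    have "\<zero>\<^bsub>?Q\<^esub> \<in> L" using L(1) additive_subgroup.zero_closed ideal.axioms(1) by blast
    then obtain K where K: "K \<in> L" "K \<noteq> \<zero>\<^bsub>?Q\<^esub>" using L(2) by blast
    obtain f where f: "f \<in> carrier R" "K = ?\<pi> f"
      using G.ex_coset_rep ideal.Icarr[OF L(1) K(1)] by blast
    then have "f \<notin> ?G" using G.coset_eq_zero_iff K(2) by blast
    then have "\<exists>p\<in>C. ?\<beta> f p \<noteq> 0" using vanishing_idealI[OF f(1)] by blast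
    then show ?thesis using f K(1) by blast
  qed
  have open_coz: "openin (beta X) {p \<in> topspace (beta X). ?\<beta> f p \<noteq> 0}" if "f \<in> carrier R" for f
    using openin_continuous_map_preimage[OF continuous_beta_extension[OF that], of "- {0}"]
    by (simp add: open_Compl)
  have "\<exists>p\<in>C. ?\<beta> u p \<noteq> 0"
  proof (rule ccontr)
    assume "\<not> ?thesis"
    then have "\<forall>p\<in>C. ?\<beta> v p \<noteq> 0" using cover by blast
    moreover obtain f p where "f \<in> carrier R" "?\<pi> f \<in> I" "p \<in> C" "?\<beta> f p \<noteq> 0"
      using nonzero[OF IJ(1,3)] by blast
    ultimately show False using orth[of f v p] v ab by auto
  qed
  moreover have "\<exists>p\<in>C. ?\<beta> v p \<noteq> 0"
  proof (rule ccontr)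
    assume "\<not> ?thesis"
    then have "\<forall>p\<in>C. ?\<beta> u p \<noteq> 0" using cover by blast
    moreover obtain f p where "f \<in> carrier R" "?\<pi> f \<in> J" "p \<in> C" "?\<beta> f p \<noteq> 0"
      using nonzero[OF IJ(2,4)] by blast
    ultimately show False using orth[of u f p] u ab by auto
  qed
  moreover have "?\<beta> u p * ?\<beta> v p = 0" if "p \<in> C" for p
    using orth[OF u(1) _ v(1) _ that] u v ab by simp
  ultimately show False
    using connectedinD[OF C open_coz[OF u(1)] open_coz[OF v(1)]] cover Cb by fastforce
qed

text \<open>
  The class of \<open>f\<close> generates a non-zero ideal, as \<open>f\<close> does not vanish at \<open>q\<close>, but a proper one, as all
  its elements vanish at \<open>p\<close>.
\<close>

lemma quotient_not_simple:
  assumes C: "C \<subseteq> topspace (beta X)" and f: "f \<in> carrier R"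
    and p: "p \<in> C" "beta_extension X f p = 0" and q: "q \<in> C" "beta_extension X f q \<noteq> 0"
  shows "\<not> simple_ideal (R Quot vanishing_ideal C) (carrier (R Quot vanishing_ideal C))"
proof
  let ?G = "vanishing_ideal C"
  let ?Q = "R Quot ?G" and ?\<pi> = "\<lambda>f. ?G +>\<^bsub>R\<^esub> f"
  interpret G: ideal ?G R using closed_ideal_vanishing[OF C] by (simp add: closed_ideal_def)
  interpret H: ring_hom_cring R ?Q ?\<pi> by (rule G.rcos_ring_hom_cring[OF R.is_cring])
  assume simple: "simple_ideal ?Q (carrier ?Q)"
  have F: "?\<pi> f \<in> carrier ?Q" using f by simp
  have "f \<notin> ?G" using q vanishing_idealD by blast
  then have "?\<pi> f \<noteq> \<zero>\<^bsub>?Q\<^esub>" using G.coset_eq_zero_iff[OF f] by blast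
  then have "PIdl\<^bsub>?Q\<^esub> ?\<pi> f \<noteq> {\<zero>\<^bsub>?Q\<^esub>}" using H.S.cgenideal_self[OF F] by blast
  moreover have ideal: "ideal (PIdl\<^bsub>?Q\<^esub> ?\<pi> f) ?Q" using F by (rule H.S.cgenideal_ideal)
  moreover have "PIdl\<^bsub>?Q\<^esub> ?\<pi> f \<subseteq> carrier ?Q" using ideal.Icarr[OF ideal] by blast
  ultimately have "PIdl\<^bsub>?Q\<^esub> ?\<pi> f = carrier ?Q"
    using simple unfolding simple_ideal_def by blast
  then have "\<one>\<^bsub>?Q\<^esub> \<in> PIdl\<^bsub>?Q\<^esub> ?\<pi> f" by simp
  then obtain y where y: "y \<in> carrier ?Q" "\<one>\<^bsub>?Q\<^esub> = y \<otimes>\<^bsub>?Q\<^esub> ?\<pi> f"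
    unfolding cgenideal_def by blast
  obtain r where r: "r \<in> carrier R" "y = ?\<pi> r" using G.ex_coset_rep[OF y(1)] by blast
  have rf: "r \<otimes>\<^bsub>R\<^esub> f \<in> carrier R" using r f by simp
  have "?\<pi> \<one>\<^bsub>R\<^esub> = ?\<pi> (r \<otimes>\<^bsub>R\<^esub> f)" using y r f by simp
  then have "\<one>\<^bsub>R\<^esub> \<in> ?\<pi> (r \<otimes>\<^bsub>R\<^esub> f)" using G.a_rcos_self[OF R.one_closed] by simp
  then obtain h where h: "h \<in> ?G" "\<one>\<^bsub>R\<^esub> = h \<oplus>\<^bsub>R\<^esub> (r \<otimes>\<^bsub>R\<^esub> f)"
    unfolding a_r_coset_def' by blast
  have pb: "p \<in> topspace (beta X)" using p C by blast
  have "beta_extension X (h \<oplus>\<^bsub>R\<^esub> (r \<otimes>\<^bsub>R\<^esub> f)) p = 0"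
    using vanishing_idealD[OF h(1) p(1)] p(2)
    unfolding beta_extension_add[OF pb G.Icarr[OF h(1)] rf] beta_extension_mult[OF pb r(1) f] by simp
  then show False using beta_extension_one[OF pb] unfolding h(2)[symmetric] by simp
qed

text \<open>
  In the compact Hausdorff space \<open>\<beta>X\<close> two closed sets are separated by a clopen set as soon as no
  connected set meets both (\<open>cut_wire_fence_theorem\<close>). A connected set on which the extension of
  a function takes the values \<open>0\<close> and \<open>1\<close> is excluded: the quotient by the functions vanishing on it
  would violate all three alternatives.
\<close>

lemma strongly_zero_dimensional_if_quotient_alternative:
  assumes X: "completely_regular_space X" "Hausdorff_space X"
    and alt: "\<And>G :: ('a \<Rightarrow> 'f) set. closed_ideal X G \<Longrightarrow>
       carrier (CB X Quot G) = {\<zero>\<^bsub>CB X Quot G\<^esub>} \<or>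
       simple_ideal (CB X Quot G) (carrier (CB X Quot G)) \<or>
       (\<exists>D. decomposable_ideal (CB X Quot G) D \<and> carrier (CB X Quot G) = quot_closure X G D)"
  shows "strongly_zero_dimensional X"
proof -
  have "separated_between X {x \<in> topspace X. f x = 0} {x \<in> topspace X. f x = 1}"
    if f: "continuous_map X (top_of_set {0..1::real}) f" for f
  proof -
    define F :: "'a \<Rightarrow> 'f" where "F = (\<lambda>x\<in>topspace X. of_real (f x))"
    have F: "F \<in> carrier R" unfolding F_def by (rule real_valued_in_CB[OF f])
    let ?S = "\<lambda>t. {p \<in> topspace (beta X). beta_extension X F p \<in> {t}}"
    have closed: "closedin (beta X) (?S t)" for t
      by (rule closedin_continuous_map_preimage[OF continuous_beta_extension[OF F]]) simp
    have "separated_between (beta X) (?S 0) (?S 1)"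
    proof (rule cut_wire_fence_theorem[OF compact_beta Hausdorff_beta closed closed])
      fix C assume C: "connectedin (beta X) C"
      show "disjnt C (?S 0) \<or> disjnt C (?S 1)"
      proof (rule ccontr)
        assume "\<not> ?thesis"
        then obtain p q where p: "p \<in> C" "beta_extension X F p = 0"
          and q: "q \<in> C" "beta_extension X F q = 1"
          unfolding disjnt_def by blast
        have Cb: "C \<subseteq> topspace (beta X)" using C by (rule connectedin_subset_topspace)
        let ?Q = "R Quot vanishing_ideal C"
        have cl: "closed_ideal X (vanishing_ideal C)" using Cb by (rule closed_ideal_vanishing)
        interpret G: ideal "vanishing_ideal C" R using cl by (simp add: closed_ideal_def)
        interpret Q: ring ?Q by (rule G.quotient_is_ring)
        have ns: "\<not> simple_ideal ?Q (carrier ?Q)"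
          using quotient_not_simple[OF Cb F p q(1)] q(2) by simp
        have "F \<notin> vanishing_ideal C" using q vanishing_idealD[of F C q] by auto
        then have "vanishing_ideal C +>\<^bsub>R\<^esub> F \<noteq> \<zero>\<^bsub>?Q\<^esub>"
          using G.coset_eq_zero_iff[OF F] by blast
        moreover have "vanishing_ideal C +>\<^bsub>R\<^esub> F \<in> carrier ?Q"
          using ring_hom_closed[OF G.rcos_ring_hom F] .
        ultimately have "carrier ?Q \<noteq> {\<zero>\<^bsub>?Q\<^esub>}" by blast
        then obtain D where "decomposable_ideal ?Q D" "carrier ?Q = quot_closure X (vanishing_ideal C) D"
          using alt[OF cl] ns by blast
        then show False
          using connected_quotient_not_decomposable[OF C] Q.one_closed by blast
      qed
    qed
    then obtain U where U: "closedin (beta X) U" "openin (beta X) U" "?S 0 \<subseteq> U"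
      "?S 1 \<subseteq> topspace (beta X) - U"
      unfolding separated_between by blast
    let ?U = "{x \<in> topspace X. beta_embed X x \<in> U}"
    note cb = continuous_beta_embed[OF X]
    have "openin X ?U" "closedin X ?U"
      using openin_continuous_map_preimage[OF cb U(2)] closedin_continuous_map_preimage[OF cb U(1)] .
    moreover have bF: "beta_embed X x \<in> topspace (beta X)" "beta_extension X F (beta_embed X x) = of_real (f x)"
      if "x \<in> topspace X" for x
      using that beta_embed_image[of X] beta_extension_embed[OF F that] by (auto simp: F_def)
    have "{x \<in> topspace X. f x = 0} \<subseteq> ?U" using U(3) bF by fastforce
    moreover have "{x \<in> topspace X. f x = 1} \<subseteq> topspace X - ?U" using U(4) bF by fastforce
    ultimately show ?thesis unfolding separated_between by blast
  qed
  then show ?thesis using X by (simp add: strongly_zero_dimensional_iff_separated_between)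
qed

text \<open>
  As \<open>H\<close> has no common zero on \<open>X\<close>, its spectrum contains \<open>X\<close>.
\<close>

lemma strongly_zero_dimensional_spectrum_iff:
  fixes H :: "('a \<Rightarrow> 'f) set"
  assumes X: "completely_regular_space X" "Hausdorff_space X"
    and H: "H \<subseteq> carrier R" "non_vanishing X H"
  shows "strongly_zero_dimensional (spectrum_space X H) \<longleftrightarrow> strongly_zero_dimensional X"
  unfolding spectrum_space_def
proof (rule strongly_zero_dimensional_between_beta[OF X])
  show "(\<Union>h\<in>H. Coz (beta X) (beta_extension X h)) \<subseteq> topspace (beta X)"
    by (auto simp: Coz_def)
  show "beta_embed X ` topspace X \<subseteq> (\<Union>h\<in>H. Coz (beta X) (beta_extension X h))"
  proof
    fix p assume "p \<in> beta_embed X ` topspace X"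
    then obtain x where x: "x \<in> topspace X" "p = beta_embed X x" by blast
    then obtain h where h: "h \<in> H" "h x \<noteq> 0" using H(2) unfolding non_vanishing_def by blast
    then have "beta_extension X h p \<noteq> 0" using x H(1) beta_extension_embed[of h x] by auto
    then show "p \<in> (\<Union>h\<in>H. Coz (beta X) (beta_extension X h))"
      using x h beta_embed_image[of X] by (auto simp: Coz_def)
  qed
qed

lemma strong_zero_dimensionality_equivalences:
  fixes H :: "('a \<Rightarrow> 'f) set"
  assumes X: "completely_regular_space X" "Hausdorff_space X"
    and H: "closed_ideal X H" "non_vanishing X H"
  shows
    "let P1 = strongly_zero_dimensional (spectrum_space X H);
         P2 = strongly_zero_dimensional X;
         P3 = (\<forall>G :: ('a \<Rightarrow> 'f) set. closed_ideal X G \<longrightarrow>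
                 G = CB_closure X (Idl\<^bsub>CB X\<^esub> {g \<in> G. g [^]\<^bsub>CB X\<^esub> (2::nat) = g}));
         P4 = (\<forall>G :: ('a \<Rightarrow> 'f) set. closed_ideal X G \<longrightarrow>
                 carrier (CB X Quot G) = {\<zero>\<^bsub>CB X Quot G\<^esub>} \<or>
                 simple_ideal (CB X Quot G) (carrier (CB X Quot G)) \<or>
                 (\<exists>D. decomposable_ideal (CB X Quot G) D \<and>
                      carrier (CB X Quot G) = quot_closure X G D))
     in (P1 \<longleftrightarrow> P2) \<and> (P2 \<longleftrightarrow> P3) \<and> (P3 \<longleftrightarrow> P4)"
proof -
  have "H \<subseteq> carrier R"
    using H(1) additive_subgroup.a_subset ideal.axioms(1) unfolding closed_ideal_def by blast
  then have 12: "strongly_zero_dimensional (spectrum_space X H) \<longleftrightarrow> strongly_zero_dimensional X"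
    using strongly_zero_dimensional_spectrum_iff[OF X] H(2) by blast
  have 23: "strongly_zero_dimensional X \<longleftrightarrow>
      (\<forall>G :: ('a \<Rightarrow> 'f) set. closed_ideal X G \<longrightarrow>
         G = CB_closure X (Idl\<^bsub>CB X\<^esub> {g \<in> G. g [^]\<^bsub>CB X\<^esub> (2::nat) = g}))"
    (is "_ \<longleftrightarrow> (\<forall>G. closed_ideal X G \<longrightarrow> ?P3 G)")
  proof
    show "\<forall>G. closed_ideal X G \<longrightarrow> ?P3 G" if "strongly_zero_dimensional X"
      by (intro allI impI) (rule closed_ideal_generated_by_idempotents[OF that])
    show "strongly_zero_dimensional X" if "\<forall>G. closed_ideal X G \<longrightarrow> ?P3 G"
      by (rule strongly_zero_dimensional_if_idempotents_generate[OF X]) (rule that[rule_format])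
  qed
  have 24: "strongly_zero_dimensional X \<longleftrightarrow>
      (\<forall>G :: ('a \<Rightarrow> 'f) set. closed_ideal X G \<longrightarrow>
         carrier (CB X Quot G) = {\<zero>\<^bsub>CB X Quot G\<^esub>} \<or>
         simple_ideal (CB X Quot G) (carrier (CB X Quot G)) \<or>
         (\<exists>D. decomposable_ideal (CB X Quot G) D \<and> carrier (CB X Quot G) = quot_closure X G D))"
    (is "_ \<longleftrightarrow> (\<forall>G. closed_ideal X G \<longrightarrow> ?P4 G)")
  proof
    show "\<forall>G. closed_ideal X G \<longrightarrow> ?P4 G" if "strongly_zero_dimensional X"
      by (intro allI impI) (rule quotient_alternative[OF that])
    show "strongly_zero_dimensional X" if "\<forall>G. closed_ideal X G \<longrightarrow> ?P4 G"
      by (rule strongly_zero_dimensional_if_quotient_alternative[OF X]) (rule that[rule_format])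
  qed
  show ?thesis
    unfolding Let_def using 12 23 24 by argo
qed

end

theorem theorem4p6:
  fixes X :: "'a topology"
  assumes "completely_regular_space X" and "Hausdorff_space X"
  shows
    "(\<forall>H :: ('a \<Rightarrow> real) set. closed_ideal X H \<and> non_vanishing X H \<longrightarrow>
        (let P1 = strongly_zero_dimensional (spectrum_space X H);
             P2 = strongly_zero_dimensional X;
             P3 = (\<forall>G :: ('a \<Rightarrow> real) set. closed_ideal X G \<longrightarrow>
                     G = CB_closure X (Idl\<^bsub>CB X\<^esub> {g \<in> G. g [^]\<^bsub>CB X\<^esub> (2::nat) = g}));
             P4 = (\<forall>G :: ('a \<Rightarrow> real) set. closed_ideal X G \<longrightarrow>
                     carrier (CB X Quot G) = {\<zero>\<^bsub>CB X Quot G\<^esub>} \<or>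
                     simple_ideal (CB X Quot G) (carrier (CB X Quot G)) \<or>
                     (\<exists>D. decomposable_ideal (CB X Quot G) D \<and>
                          carrier (CB X Quot G) = quot_closure X G D))
         in (P1 \<longleftrightarrow> P2) \<and> (P2 \<longleftrightarrow> P3) \<and> (P3 \<longleftrightarrow> P4)))
     \<and>
     (\<forall>H :: ('a \<Rightarrow> complex) set. closed_ideal X H \<and> non_vanishing X H \<longrightarrow>
        (let P1 = strongly_zero_dimensional (spectrum_space X H);
             P2 = strongly_zero_dimensional X;
             P3 = (\<forall>G :: ('a \<Rightarrow> complex) set. closed_ideal X G \<longrightarrow>
                     G = CB_closure X (Idl\<^bsub>CB X\<^esub> {g \<in> G. g [^]\<^bsub>CB X\<^esub> (2::nat) = g}));
             P4 = (\<forall>G :: ('a \<Rightarrow> complex) set. closed_ideal X G \<longrightarrow>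
                     carrier (CB X Quot G) = {\<zero>\<^bsub>CB X Quot G\<^esub>} \<or>
                     simple_ideal (CB X Quot G) (carrier (CB X Quot G)) \<or>
                     (\<exists>D. decomposable_ideal (CB X Quot G) D \<and>
                          carrier (CB X Quot G) = quot_closure X G D))
         in (P1 \<longleftrightarrow> P2) \<and> (P2 \<longleftrightarrow> P3) \<and> (P3 \<longleftrightarrow> P4)))"
proof -
  interpret real: beta_extendable X "TYPE(real)"
    by unfold_locales (rule beta_extension_real)
  interpret complex: beta_extendable X "TYPE(complex)"
    by unfold_locales (rule beta_extension_complex)
  show ?thesis
    using real.strong_zero_dimensionality_equivalences[OF assms]
      complex.strong_zero_dimensionality_equivalences[OF assms] by blast
qed

end
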